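(* Let $\mu,\nu$ be real numbers, and let $f_1=h_1+\overline{g_1}$ be the harmonic right half-plane mapping given by $$h_1(z)=\frac12\left(\frac{z}{1-z}+\frac{z}{(1-z)^2}\right),\qquad g_1(z)=\frac12\left(\frac{z}{1-z}-\frac{z}{(1-z)^2}\right).$$ Let $f_2=h_2+\overline{g_2}$ be a locally univalent and sense-preserving harmonic mapping in $\mathbb{D}$ such that $$h_2(z)+e^{-2i\mu}g_2(z)=\int_0^z \frac{d\xi}{1-2\xi e^{i\mu}\cos\nu+\xi^2e^{2i\mu}},\quad z\in\mathbb{D},$$ and let $\omega(z)=az^n$ (with $a\in\mathbb{C}$, $|a|\le 1$, $n\in\mathbb{N}$) be the analytic dilatation of $f_2$. Then the convolution $f_1*f_2$ is univalent and convex in the direction of $-\mu$ if either (1) $n=1,2$ and $|a|\leq 1$, or (2) $n\geq3$ and $|a|\leq n-1-\sqrt{n^2-2n}$.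
   Context: $\mathbb{D}=\{z\in\mathbb{C}:|z|<1\}$ and $\mathbb{N}=\{1,2,\dots\}$. Every complex-valued harmonic function on $\mathbb{D}$ is written $f=h+\overline{g}$ with $h,g$ analytic in $\mathbb{D}$, and is assumed normalized: $h(0)=h'(0)-1=g(0)=0$. Such $f$ is locally univalent and sense-preserving iff $|g'|<|h'|$ on $\mathbb{D}$; its analytic dilatation is $\omega=g'/h'$. For analytic $\phi_1(z)=\sum_{n\ge0} a_nz^n$, $\phi_2(z)=\sum_{n\ge0} b_nz^n$ the convolution is $(\phi_1*\phi_2)(z)=\sum_{n\ge0} a_nb_nz^n$. For harmonic $f_1=h_1+\overline{g_1}$, $f_2=h_2+\overline{g_2}$, $f_1*f_2:=h_1*h_2+\overline{g_1*g_2}$. For real $\gamma$, a domain is convex in the direction of $\gamma$ if every line parallel to the line joining the origin to $e^{i\gamma}$ has connected (possibly empty) intersection with it. A function on $\mathbb{D}$ is convex in the direction of $\gamma$ if it maps $\mathbb{D}$ onto a domain convex in the direction of $\gamma$. *)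

theory Defs
  imports "HOL-Complex_Analysis.Complex_Analysis"
begin

definition harmonic_fun :: "(complex \<Rightarrow> complex) \<Rightarrow> (complex \<Rightarrow> complex) \<Rightarrow> complex \<Rightarrow> complex" where
  "harmonic_fun h g = (\<lambda>z. h z + cnj (g z))"

text \<open>
  With the normalization \<open>g 0 = 0\<close> the pair \<open>(h, g)\<close> is determined by the function
  \<open>harmonic_fun h g\<close> on the disc; operations on harmonic functions are therefore stated on the pairs.
\<close>

definition normalized_harmonic :: "(complex \<Rightarrow> complex) \<Rightarrow> (complex \<Rightarrow> complex) \<Rightarrow> bool" where
  "normalized_harmonic h g \<longleftrightarrow>
     h holomorphic_on ball 0 1 \<and> g holomorphic_on ball 0 1 \<and>
     h 0 = 0 \<and> deriv h 0 = 1 \<and> g 0 = 0"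

definition conv :: "(complex \<Rightarrow> complex) \<Rightarrow> (complex \<Rightarrow> complex) \<Rightarrow> complex \<Rightarrow> complex" where
  "conv \<phi>1 \<phi>2 =
     (\<lambda>z. \<Sum>n. fps_nth (fps_expansion \<phi>1 0) n * fps_nth (fps_expansion \<phi>2 0) n * z ^ n)"

definition harmonic_conv ::
  "(complex \<Rightarrow> complex) \<Rightarrow> (complex \<Rightarrow> complex) \<Rightarrow> (complex \<Rightarrow> complex) \<Rightarrow> (complex \<Rightarrow> complex)
     \<Rightarrow> complex \<Rightarrow> complex" where
  "harmonic_conv h1 g1 h2 g2 = harmonic_fun (conv h1 h2) (conv g1 g2)"

definition locally_univalent_on :: "(complex \<Rightarrow> complex) \<Rightarrow> complex set \<Rightarrow> bool" where
  "locally_univalent_on f S \<longleftrightarrow> (\<forall>z\<in>S. \<exists>U. open U \<and> z \<in> U \<and> U \<subseteq> S \<and> inj_on f U)"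

text \<open>
  The determinant of the real derivative of \<open>f\<close> at \<open>z\<close>, its columns being the partial derivatives
  \<open>f\<^sub>x\<close> and \<open>f\<^sub>y\<close>.
\<close>

definition jacobian_det :: "(complex \<Rightarrow> complex) \<Rightarrow> complex \<Rightarrow> real" where
  "jacobian_det f z =
     (let D = frechet_derivative f (at z)
      in Re (D 1) * Im (D \<i>) - Im (D 1) * Re (D \<i>))"

definition sense_preserving_on :: "(complex \<Rightarrow> complex) \<Rightarrow> complex set \<Rightarrow> bool" where
  "sense_preserving_on f S \<longleftrightarrow> (\<forall>z\<in>S. jacobian_det f z > 0)"

lemma jacobian_det_harmonic_fun:
  assumes "h field_differentiable (at z)" "g field_differentiable (at z)"
  shows "jacobian_det (harmonic_fun h g) z = (cmod (deriv h z))\<^sup>2 - (cmod (deriv g z))\<^sup>2"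
proof -
  have h: "(h has_derivative (*) (deriv h z)) (at z)"
    and g: "(g has_derivative (*) (deriv g z)) (at z)"
    using assms by (auto simp: field_differentiable_derivI has_field_derivative_imp_has_derivative)
  have "(harmonic_fun h g has_derivative (\<lambda>v. deriv h z * v + cnj (deriv g z * v))) (at z)"
    unfolding harmonic_fun_def by (intro has_derivative_add h has_derivative_cnj g)
  then have "frechet_derivative (harmonic_fun h g) (at z) = (\<lambda>v. deriv h z * v + cnj (deriv g z * v))"
    by (rule frechet_derivative_at[symmetric])
  then show ?thesis
    unfolding cmod_power2 by (simp add: jacobian_det_def power2_eq_square algebra_simps)
qed

definition convex_in_direction :: "real \<Rightarrow> complex set \<Rightarrow> bool" where
  "convex_in_direction \<gamma> \<Omega> \<longleftrightarrow>
     (\<forall>w. connected (range (\<lambda>t::real. w + of_real t * cis \<gamma>) \<inter> \<Omega>))"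

definition function_convex_in_direction :: "real \<Rightarrow> (complex \<Rightarrow> complex) \<Rightarrow> bool" where
  "function_convex_in_direction \<gamma> f \<longleftrightarrow>
     open (f ` ball 0 1) \<and> connected (f ` ball 0 1) \<and> convex_in_direction \<gamma> (f ` ball 0 1)"

end

theory Submission
  imports Defs "HOL-Real_Asymp.Real_Asymp"
begin

text \<open>
  Convolution with the half-plane mapping acts on power series as a first-order differential
  operator: \<open>f\<^sub>1 * f\<^sub>2\<close> has analytic part \<open>H = (h\<^sub>2 + z h\<^sub>2') / 2\<close> and co-analytic part
  \<open>G = (g\<^sub>2 - z g\<^sub>2') / 2\<close> (lemma \<open>conv_half_plane\<close>).  Write \<open>w = e\<^sup>i\<^sup>\<mu> z\<close>, \<open>q = 1 - 2 w cos \<nu> + w\<^sup>2\<close>,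
  \<open>c = e\<^sup>-\<^sup>2\<^sup>i\<^sup>\<mu>\<close> and \<open>u = c a z\<^sup>n\<close>.  The integral hypothesis says \<open>h\<^sub>2' + c g\<^sub>2' = 1 / q\<close>, and with
  \<open>g\<^sub>2' = a z\<^sup>n h\<^sub>2'\<close> this gives \<open>h\<^sub>2' = 1 / (q (1 + u))\<close>.  Everything is then explicit in terms of \<open>u\<close> and
  \<open>p = (1 - w\<^sup>2) / q\<close>, a function with positive real part.  Univalence and directional convexity
  follow by shearing (lemma \<open>shear_construction\<close>): it is enough that \<open>|G'| < |H'|\<close> and that the analytic
  function \<open>H - c G\<close> is injective with image convex in the direction of \<open>-\<mu>\<close>.

  The inequality \<open>|G'| < |H'|\<close> reads \<open>|u (A + n - 2)| < |A|\<close> with \<open>A = 1 + p - n u / (1 + u)\<close>.  The points \<open>A\<close>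
  violating it form an Apollonius disc whose rightmost point is \<open>(n - 2) r / (1 - r)\<close> when \<open>n \<ge> 2\<close>,
  \<open>r = |u|\<close>, while \<open>Re A > 1 - n r / (1 + r)\<close>.  The second bound is at least the first exactly when
  \<open>r\<^sup>2 - 2 (n - 1) r + 1 \<ge> 0\<close>, that is, for \<open>n \<ge> 3\<close> and \<open>r < 1\<close>, when \<open>r \<le> n - 1 - sqrt (n\<^sup>2 - 2 n)\<close>; this is the
  origin of the bound on \<open>|a|\<close> (lemma \<open>dilatation_estimate\<close>).

  For the convexity, \<open>e\<^sup>i\<^sup>\<mu> (H - c G)\<close>, as a function of \<open>w\<close>, has derivative
  \<open>((1 - u) / (1 + u) + p) / (2 q)\<close>.  In the coordinate \<open>\<kappa> = \<integral> dw / q\<close>, which maps the disc onto a vertical strip or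
  half-plane, the derivative has positive real part.  The imaginary part therefore increases along each
  vertical line, and it runs from \<open>-\<infinity>\<close> to \<open>\<infinity>\<close> there because of the summand coming from \<open>p\<close>, whose primitive is
  \<open>w / q\<close>.  Each level set of the imaginary part is then the graph of a continuous function over an interval,
  hence connected, and this is convexity in the horizontal direction (lemmas
  \<open>horizontally_convex_image_of_strip\<close> and \<open>horizontally_convex_of_kernel\<close>).
\<close>

section \<open>Convexity in a direction\<close>

text \<open>
  Testing connectedness on the parameter interval instead of the line lets one-variable
  calculus apply to the intersection with each line.
\<close>

lemma convex_in_direction_iff_connected_parameters:
  "convex_in_direction \<gamma> \<Omega> \<longleftrightarrow> (\<forall>w. connected {t::real. w + of_real t * cis \<gamma> \<in> \<Omega>})"
proof -
  have "connected (range (\<lambda>t::real. w + of_real t * cis \<gamma>) \<inter> \<Omega>) \<longleftrightarrow>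
        connected {t::real. w + of_real t * cis \<gamma> \<in> \<Omega>}" (is "connected ?L \<longleftrightarrow> connected ?I") for w
  proof
    assume "connected ?L"
    then have "connected ((\<lambda>\<zeta>. Re ((\<zeta> - w) * cis (- \<gamma>))) ` ?L)"
      by (intro connected_continuous_image continuous_intros)
    moreover have "Re ((w + of_real t * cis \<gamma> - w) * cis (- \<gamma>)) = t" for t
      by (simp add: mult.assoc cis_mult del: cis.simps times_complex.sel)
    then have "?I = (\<lambda>\<zeta>. Re ((\<zeta> - w) * cis (- \<gamma>))) ` (\<lambda>t. w + of_real t * cis \<gamma>) ` ?I"
      by (simp only: image_image image_ident)
    moreover have "?L = (\<lambda>t. w + of_real t * cis \<gamma>) ` ?I" by auto
    ultimately show "connected ?I" by simp
  next
    assume "connected ?I"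
    then have "connected ((\<lambda>t::real. w + of_real t * cis \<gamma>) ` ?I)"
      by (intro connected_continuous_image continuous_intros)
    moreover have "(\<lambda>t::real. w + of_real t * cis \<gamma>) ` ?I = ?L" by auto
    ultimately show "connected ?L" by simp
  qed
  then show ?thesis by (simp add: convex_in_direction_def)
qed

lemma convex_in_direction_rotate:
  assumes "convex_in_direction \<gamma> \<Omega>"
  shows "convex_in_direction (\<gamma> + \<beta>) ((*) (cis \<beta>) ` \<Omega>)"
proof -
  have "{t::real. w + of_real t * cis (\<gamma> + \<beta>) \<in> (*) (cis \<beta>) ` \<Omega>} =
        {t. cis (- \<beta>) * w + of_real t * cis \<gamma> \<in> \<Omega>}" for w
  proof -
    have "z \<in> (*) (cis \<beta>) ` \<Omega> \<longleftrightarrow> cis (- \<beta>) * z \<in> \<Omega>" for z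
    proof -
      have 1: "cis \<beta> * (cis (- \<beta>) * z) = z" "\<And>y. cis (- \<beta>) * (cis \<beta> * y) = y"
        by (simp_all add: mult.assoc[symmetric] cis_mult)
      show ?thesis using 1 by (metis (no_types, lifting) image_iff)
    qed
    moreover have "cis (- \<beta>) * (w + of_real t * cis (\<gamma> + \<beta>)) = cis (- \<beta>) * w + of_real t * cis \<gamma>" for t
      by (simp add: distrib_left mult.left_commute cis_mult)
    ultimately show ?thesis by simp
  qed
  with assms show ?thesis unfolding convex_in_direction_iff_connected_parameters by simp
qed

section \<open>The shear construction\<close>

lemma has_real_derivative_Re:
  fixes f :: "complex \<Rightarrow> complex"
  assumes "(f has_field_derivative d) (at (of_real t))"
  shows "((\<lambda>t. Re (f (of_real t))) has_real_derivative Re d) (at t)"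
  using bounded_linear.has_vector_derivative[OF bounded_linear_Re has_vector_derivative_real_field[OF assms]]
  by (simp add: has_real_derivative_iff_has_vector_derivative)

lemma has_real_derivative_Im:
  fixes f :: "complex \<Rightarrow> complex"
  assumes "(f has_field_derivative d) (at (of_real t))"
  shows "((\<lambda>t. Im (f (of_real t))) has_real_derivative Im d) (at t)"
  using bounded_linear.has_vector_derivative[OF bounded_linear_Im has_vector_derivative_real_field[OF assms]]
  by (simp add: has_real_derivative_iff_has_vector_derivative)

text \<open>
  The Cayley transform maps the unit disc to the right half-plane.
\<close>

lemma Re_Cayley_pos:
  assumes "cmod B < 1"
  shows "Re ((1 + B) / (1 - B)) > 0"
proof -
  have "B \<noteq> 1" using assms by auto
  have "Re ((1 + B) * cnj (1 - B)) = 1 - (cmod B)\<^sup>2"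
    by (simp add: cmod_power2) (simp add: algebra_simps power2_eq_square)
  also have "\<dots> > 0" using assms by (simp add: abs_square_less_1)
  finally show ?thesis using \<open>B \<noteq> 1\<close> by (simp only: Re_complex_div_gt_0)
qed

text \<open>
  The sufficient half of the shear theorem of Clunie and Sheil-Small.  Since
  \<open>H + cnj G = \<Psi> + 2 Re (e\<^sup>i\<^sup>\<gamma> G) e\<^sup>i\<^sup>\<gamma>\<close>, the harmonic function differs from \<open>\<Psi>\<close> by a real multiple of
  the direction \<open>e\<^sup>i\<^sup>\<gamma>\<close>.  Transported to the image of \<open>\<Psi>\<close>, it maps each line in that direction into itself,
  and its derivative along the line is \<open>Re ((1 + B) / (1 - B))\<close> with \<open>B = e\<^sup>2\<^sup>i\<^sup>\<gamma> G' / H'\<close>, which is positive.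
  So it is strictly increasing on the interval that the line cuts out of the image of \<open>\<Psi>\<close>.
\<close>

lemma shear_construction:
  fixes H G :: "complex \<Rightarrow> complex" and \<gamma> :: real
  defines "\<Psi> \<equiv> \<lambda>z. H z - cis (2 * \<gamma>) * G z"
  assumes D: "open D" and hol: "H holomorphic_on D" "G holomorphic_on D"
    and dil: "\<And>z. z \<in> D \<Longrightarrow> cmod (deriv G z) < cmod (deriv H z)"
    and inj: "inj_on \<Psi> D" and cvx: "convex_in_direction \<gamma> (\<Psi> ` D)"
  shows "inj_on (harmonic_fun H G) D" "convex_in_direction \<gamma> (harmonic_fun H G ` D)"
proof -
  have \<Psi>_hol: "\<Psi> holomorphic_on D"
    unfolding \<Psi>_def by (intro holomorphic_intros hol)
  obtain \<Theta> where \<Theta>_hol: "\<Theta> holomorphic_on \<Psi> ` D"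
    and \<Theta>_deriv: "\<And>z. z \<in> D \<Longrightarrow> deriv \<Psi> z * deriv \<Theta> (\<Psi> z) = 1"
    and \<Theta>: "\<And>z. z \<in> D \<Longrightarrow> \<Theta> (\<Psi> z) = z"
    using holomorphic_has_inverse[OF \<Psi>_hol D inj] by metis
  have open_image: "open (\<Psi> ` D)"
    using open_mapping_thm3[OF \<Psi>_hol D inj] .
  have f_eq: "harmonic_fun H G z = \<Psi> z + of_real (2 * Re (cis \<gamma> * G z)) * cis \<gamma>" for z
  proof -
    have "of_real (2 * Re (cis \<gamma> * G z)) * cis \<gamma> = (cis \<gamma> * G z + cnj (cis \<gamma> * G z)) * cis \<gamma>"
      by (simp only: complex_add_cnj)
    also have "\<dots> = cis (2 * \<gamma>) * G z + cnj (G z)"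
      unfolding mult.commute[of _ "cis \<gamma>"] by (simp add: distrib_left cis_cnj cis_mult flip: mult.assoc)
    finally show ?thesis by (simp add: harmonic_fun_def \<Psi>_def)
  qed
  define k where "k w t = t + 2 * Re (cis \<gamma> * G (\<Theta> (w + of_real t * cis \<gamma>)))" for w and t :: real
  define I where "I w = {t::real. w + of_real t * cis \<gamma> \<in> \<Psi> ` D}" for w
  have f_k: "harmonic_fun H G z = w + of_real (k w t) * cis \<gamma>" if "z \<in> D" "\<Psi> z = w + of_real t * cis \<gamma>" for z w t
    using that \<Theta>[of z] by (simp add: f_eq k_def algebra_simps)
  have k_deriv: "\<exists>d>0. (k w has_real_derivative d) (at t)" if t: "t \<in> I w" for w t
  proof -
    obtain z where z: "z \<in> D" "\<Psi> z = w + of_real t * cis \<gamma>" using t by (auto simp: I_def)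
    have dH: "(H has_field_derivative deriv H z) (at z)" and dG: "(G has_field_derivative deriv G z) (at z)"
      by (rule holomorphic_derivI[OF hol(1) D z(1)], rule holomorphic_derivI[OF hol(2) D z(1)])
    have d\<Psi>: "deriv \<Psi> z = deriv H z - cis (2 * \<gamma>) * deriv G z"
      unfolding \<Psi>_def by (intro DERIV_imp_deriv DERIV_diff DERIV_cmult dH dG)
    define B where "B = cis (2 * \<gamma>) * deriv G z / deriv H z"
    have H0: "deriv H z \<noteq> 0" using dil[OF z(1)] by auto
    have B: "cmod B < 1" using dil[OF z(1)] H0 by (simp add: B_def norm_mult norm_divide)
    have "deriv \<Psi> z \<noteq> 0" using \<Theta>_deriv[OF z(1)] by auto
    have d\<Theta>: "(\<Theta> has_field_derivative 1 / deriv \<Psi> z) (at (w + of_real t * cis \<gamma>))"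
    proof -
      have "(\<Theta> has_field_derivative deriv \<Theta> (\<Psi> z)) (at (\<Psi> z))"
        by (rule holomorphic_derivI[OF \<Theta>_hol open_image imageI[OF z(1)]])
      moreover have "deriv \<Theta> (\<Psi> z) = 1 / deriv \<Psi> z"
        using \<Theta>_deriv[OF z(1)] \<open>deriv \<Psi> z \<noteq> 0\<close> by (simp add: field_simps)
      ultimately show ?thesis using z(2) by simp
    qed
    have dG': "(G has_field_derivative deriv G z) (at (\<Theta> (w + of_real t * cis \<gamma>)))"
      using dG \<Theta>[OF z(1)] z(2) by simp
    have "((\<lambda>\<xi>. \<Theta> (w + \<xi> * cis \<gamma>)) has_field_derivative 1 / deriv \<Psi> z * cis \<gamma>) (at (of_real t))"
      by (rule DERIV_chain2[where f=\<Theta> and g="\<lambda>\<xi>. w + \<xi> * cis \<gamma>" and x="of_real t", OF d\<Theta>])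
        (auto intro!: derivative_eq_intros)
    from DERIV_cmult[OF DERIV_chain2[where f=G and g="\<lambda>\<xi>. \<Theta> (w + \<xi> * cis \<gamma>)" and x="of_real t", OF dG' this], of "cis \<gamma>"]
    have "((\<lambda>\<xi>. cis \<gamma> * G (\<Theta> (w + \<xi> * cis \<gamma>))) has_field_derivative
            cis \<gamma> * (deriv G z * (1 / deriv \<Psi> z * cis \<gamma>))) (at (of_real t))" .
    moreover have "cis \<gamma> * (deriv G z * (1 / deriv \<Psi> z * cis \<gamma>)) = B / (1 - B)"
    proof -
      have "deriv \<Psi> z = deriv H z * (1 - B)" using H0 by (simp add: d\<Psi> B_def field_simps)
      then have "B / (1 - B) = cis (2 * \<gamma>) * deriv G z / deriv \<Psi> z" by (simp add: B_def)
      also have "cis (2 * \<gamma>) = cis \<gamma> * cis \<gamma>" by (simp add: cis_mult)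
      finally show ?thesis by (simp add: mult_ac)
    qed
    ultimately have "((\<lambda>\<xi>. cis \<gamma> * G (\<Theta> (w + \<xi> * cis \<gamma>))) has_field_derivative B / (1 - B)) (at (of_real t))"
      by simp
    from has_real_derivative_Re[OF this]
    have "((\<lambda>t. Re (cis \<gamma> * G (\<Theta> (w + of_real t * cis \<gamma>)))) has_real_derivative Re (B / (1 - B))) (at t)" .
    then have "(k w has_real_derivative 1 + 2 * Re (B / (1 - B))) (at t)"
      unfolding k_def by (intro DERIV_add DERIV_ident DERIV_cmult)
    moreover have "1 + 2 * Re (B / (1 - B)) > 0"
    proof -
      define X where "X = B / (1 - B)"
      have "B \<noteq> 1" using B by auto
      then have "(1 + B) / (1 - B) = 1 + 2 * X" by (simp add: X_def divide_simps)
      with Re_Cayley_pos[OF B] show ?thesis by (simp flip: X_def)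
    qed
    ultimately show ?thesis by blast
  qed
  have I_conn: "connected (I w)" for w
    using cvx by (simp add: convex_in_direction_iff_connected_parameters I_def)
  have k_less: "k w s < k w t" if "s \<in> I w" "t \<in> I w" "s < t" for w s t
  proof (rule DERIV_pos_imp_increasing[OF \<open>s < t\<close>, of "k w"])
    fix x assume "s \<le> x" "x \<le> t"
    then have "x \<in> I w" using I_conn[of w] that connectedD_interval by blast
    then show "\<exists>y. (k w has_real_derivative y) (at x) \<and> 0 < y" using k_deriv by blast
  qed
  show "inj_on (harmonic_fun H G) D"
  proof (rule inj_onI)
    fix z1 z2 assume z: "z1 \<in> D" "z2 \<in> D" "harmonic_fun H G z1 = harmonic_fun H G z2"
    define t where "t = 2 * Re (cis \<gamma> * G z1) - 2 * Re (cis \<gamma> * G z2)"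
    have e: "\<Psi> z2 = \<Psi> z1 + of_real t * cis \<gamma>"
      using z(3) by (simp add: f_eq t_def algebra_simps)
    have "0 \<in> I (\<Psi> z1)" "t \<in> I (\<Psi> z1)"
      using z imageI[OF z(2), of \<Psi>] e by (simp_all add: I_def)
    moreover have "k (\<Psi> z1) 0 = k (\<Psi> z1) t"
      using f_k[OF z(1), of "\<Psi> z1" 0] f_k[OF z(2) e] z(3) by simp
    ultimately have "t = 0" using k_less by (metis linorder_neqE_linordered_idom less_irrefl)
    then show "z1 = z2" using e inj z by (auto dest: inj_onD)
  qed
  have "{s. w + of_real s * cis \<gamma> \<in> harmonic_fun H G ` D} = k w ` I w" for w
  proof (intro equalityI subsetI)
    fix s assume "s \<in> {s. w + of_real s * cis \<gamma> \<in> harmonic_fun H G ` D}"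
    then obtain z where z: "z \<in> D" "harmonic_fun H G z = w + of_real s * cis \<gamma>" by auto
    define t where "t = s - 2 * Re (cis \<gamma> * G z)"
    have e: "\<Psi> z = w + of_real t * cis \<gamma>" using z(2) by (simp add: f_eq t_def algebra_simps)
    then have "t \<in> I w" using z(1) by (force simp: I_def)
    moreover have "k w t = s" using f_k[OF z(1) e] z(2) by simp
    ultimately show "s \<in> k w ` I w" by blast
  next
    fix s assume "s \<in> k w ` I w"
    then obtain t z where "s = k w t" "z \<in> D" "\<Psi> z = w + of_real t * cis \<gamma>" by (auto simp: I_def)
    with f_k[of z w t] show "s \<in> {s. w + of_real s * cis \<gamma> \<in> harmonic_fun H G ` D}"
      by (metis (mono_tags, lifting) imageI mem_Collect_eq)
  qed
  moreover have "connected (k w ` I w)" for w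
  proof (intro connected_continuous_image I_conn continuous_at_imp_continuous_on ballI)
    show "isCont (k w) t" if "t \<in> I w" for t using k_deriv[OF that] DERIV_isCont by blast
  qed
  ultimately show "convex_in_direction \<gamma> (harmonic_fun H G ` D)"
    by (simp add: convex_in_direction_iff_connected_parameters)
qed

section \<open>Convexity criteria in the horizontal direction\<close>

text \<open>
  The real part condition makes \<open>Im k\<close> strictly increasing along vertical lines, and the limits make it
  onto the reals there.  A level set of \<open>Im k\<close> thus is the graph of a function on \<open>J\<close>, and monotonicity
  makes this function continuous.  So the level set is connected, and \<open>k\<close> maps it onto the intersection of
  its image with a horizontal line.  Injectivity is the Noshiro--Warschawski argument on a convex domain.
\<close>

lemma horizontally_convex_image_of_strip:
  fixes J :: "real set" and k :: "complex \<Rightarrow> complex"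
  defines "S \<equiv> {z. Re z \<in> J}"
  assumes J: "open J" "connected J" and hol: "k holomorphic_on S"
    and pos: "\<And>z. z \<in> S \<Longrightarrow> Re (deriv k z) > 0"
    and top: "\<And>x. x \<in> J \<Longrightarrow> filterlim (\<lambda>y. Im (k (Complex x y))) at_top at_top"
    and bot: "\<And>x. x \<in> J \<Longrightarrow> filterlim (\<lambda>y. Im (k (Complex x y))) at_bot at_bot"
  shows "inj_on k S" "convex_in_direction 0 (k ` S)"
proof -
  have openS: "open S" unfolding S_def using open_vimage[OF J(1), of Re] by (simp add: vimage_def continuous_on_Re)
  have convS: "convex S"
    using J(2) convex_linear_vimage[of Re J] bounded_linear.linear[OF bounded_linear_Re]
    by (simp add: S_def vimage_def is_interval_connected_1 flip: is_interval_convex_1)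
  show inj: "inj_on k S"
  proof (rule inj_onI, rule ccontr)
    fix z1 z2 assume z: "z1 \<in> S" "z2 \<in> S" "k z1 = k z2" "z1 \<noteq> z2"
    define d where "d = z2 - z1"
    define m where "m t = Re (k (z1 + of_real t * d) / d)" for t :: real
    have "d \<noteq> 0" using z by (simp add: d_def)
    have "m 0 < m 1"
    proof (rule DERIV_pos_imp_increasing[of 0 1 m])
      fix t :: real assume t: "0 \<le> t" "t \<le> 1"
      have S: "z1 + of_real t * d \<in> S"
        using convexD_alt[OF convS z(1,2) t] by (simp add: d_def algebra_simps scaleR_conv_of_real)
      have dk: "(k has_field_derivative deriv k (z1 + of_real t * d)) (at (z1 + of_real t * d))"
        by (rule holomorphic_derivI[OF hol openS S])
      have "((\<lambda>\<xi>. k (z1 + \<xi> * d)) has_field_derivative deriv k (z1 + of_real t * d) * d) (at (of_real t))"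
        by (rule DERIV_chain2[where f=k and g="\<lambda>\<xi>. z1 + \<xi> * d" and x="of_real t", OF dk]) (auto intro!: derivative_eq_intros)
      from DERIV_cdivide[OF this, of d]
      have "((\<lambda>\<xi>. k (z1 + \<xi> * d) / d) has_field_derivative deriv k (z1 + of_real t * d)) (at (of_real t))"
        using \<open>d \<noteq> 0\<close> by simp
      from has_real_derivative_Re[OF this]
      have "(m has_real_derivative Re (deriv k (z1 + of_real t * d))) (at t)"
        by (simp add: m_def[abs_def])
      then show "\<exists>y. (m has_real_derivative y) (at t) \<and> 0 < y" using pos[OF S] by blast
    qed simp
    then show False using z(3) by (simp add: m_def d_def)
  qed
  have contk: "continuous_on S k" using hol by (rule holomorphic_on_imp_continuous_on)
  have inc: "Im (k (Complex x y1)) < Im (k (Complex x y2))" if "x \<in> J" "y1 < y2" for x y1 y2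
  proof (rule DERIV_pos_imp_increasing[OF \<open>y1 < y2\<close>, of "\<lambda>y. Im (k (Complex x y))"])
    fix y
    have S: "of_real x + \<i> * of_real y \<in> S" using \<open>x \<in> J\<close> by (simp add: S_def)
    have dk: "(k has_field_derivative deriv k (of_real x + \<i> * of_real y)) (at (of_real x + \<i> * of_real y))"
      by (rule holomorphic_derivI[OF hol openS S])
    have "((\<lambda>\<xi>. k (of_real x + \<i> * \<xi>)) has_field_derivative deriv k (of_real x + \<i> * of_real y) * \<i>) (at (of_real y))"
      by (rule DERIV_chain2[where f=k and g="\<lambda>\<xi>. of_real x + \<i> * \<xi>" and x="of_real y", OF dk]) (auto intro!: derivative_eq_intros)
    from has_real_derivative_Im[OF this]
    have "((\<lambda>y. Im (k (Complex x y))) has_real_derivative Re (deriv k (of_real x + \<i> * of_real y))) (at y)"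
      by (simp add: Complex_eq)
    then show "\<exists>d. ((\<lambda>y. Im (k (Complex x y))) has_real_derivative d) (at y) \<and> 0 < d" using pos[OF S] by blast
  qed
  have contv: "continuous_on J (\<lambda>x. Im (k (Complex x y)))" for y
    by (intro continuous_intros continuous_on_compose2[OF contk]) (auto simp: S_def Complex_eq intro!: continuous_intros)
  have ex: "\<exists>y. Im (k (Complex x y)) = v" if x: "x \<in> J" for x v
  proof -
    obtain y1 where y1: "Im (k (Complex x y1)) \<le> v"
      using eventually_happens[OF filterlim_at_bot[THEN iffD1, OF bot[OF x], rule_format, of v]] by auto
    obtain y2 where y2: "v \<le> Im (k (Complex x y2))"
      using eventually_happens[OF filterlim_at_top[THEN iffD1, OF top[OF x], rule_format, of v]] by auto
    have "y1 \<le> y2" using inc[OF x, of y2 y1] y1 y2 by force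
    moreover have "continuous_on {y1..y2} (\<lambda>y. Im (k (Complex x y)))"
      by (intro continuous_intros continuous_on_compose2[OF contk]) (use x in \<open>auto simp: S_def Complex_eq intro!: continuous_intros\<close>)
    ultimately show ?thesis using IVT'[of "\<lambda>y. Im (k (Complex x y))" y1 v y2] y1 y2 by auto
  qed
  have level: "connected {z \<in> S. Im (k z) = v}" for v
  proof -
    define Y where "Y x = (SOME y. Im (k (Complex x y)) = v)" for x
    have Y: "Im (k (Complex x (Y x))) = v" if "x \<in> J" for x
      unfolding Y_def using someI_ex[OF ex[OF that]] .
    have Y_less: "Y x < y \<longleftrightarrow> v < Im (k (Complex x y))" "y < Y x \<longleftrightarrow> Im (k (Complex x y)) < v"
      if "x \<in> J" for x y
      using inc[OF that, of y "Y x"] inc[OF that, of "Y x" y] Y[OF that]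
      by (cases y "Y x" rule: linorder_cases; force)+
    \<comment> \<open>A strict inequality between \<open>Y x\<close> and \<open>y\<close> is one between \<open>v\<close> and \<open>Im k(x + i y)\<close>, an open condition on \<open>x\<close>.\<close>
    have "continuous_on J Y"
      unfolding continuous_on_def
    proof (intro ballI order_tendstoI)
      fix x y assume x: "x \<in> J" and y: "y < Y x"
      have "((\<lambda>x. Im (k (Complex x y))) \<longlongrightarrow> Im (k (Complex x y))) (at x within J)"
        using contv x by (auto simp: continuous_on_def)
      from order_tendstoD(2)[OF this, of v] have "\<forall>\<^sub>F x in at x within J. Im (k (Complex x y)) < v"
        using Y_less[OF x] y by simp
      then show "\<forall>\<^sub>F x in at x within J. y < Y x"
        by (auto simp: eventually_at_filter Y_less elim!: eventually_mono)
    next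
      fix x y assume x: "x \<in> J" and y: "Y x < y"
      have "((\<lambda>x. Im (k (Complex x y))) \<longlongrightarrow> Im (k (Complex x y))) (at x within J)"
        using contv x by (auto simp: continuous_on_def)
      from order_tendstoD(1)[OF this, of v] have "\<forall>\<^sub>F x in at x within J. v < Im (k (Complex x y))"
        using Y_less[OF x] y by simp
      then show "\<forall>\<^sub>F x in at x within J. Y x < y"
        by (auto simp: eventually_at_filter Y_less elim!: eventually_mono)
    qed
    have "connected ((\<lambda>x. Complex x (Y x)) ` J)"
      unfolding Complex_eq by (intro connected_continuous_image J continuous_intros \<open>continuous_on J Y\<close>)
    moreover have "(\<lambda>x. Complex x (Y x)) ` J = {z \<in> S. Im (k z) = v}"
    proof (intro equalityI subsetI)
      fix z assume z: "z \<in> {z \<in> S. Im (k z) = v}"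
      then have "Re z \<in> J" by (simp add: S_def)
      moreover have "Im z = Y (Re z)"
        using Y_less[OF \<open>Re z \<in> J\<close>, of "Im z"] z by (cases "Im z" "Y (Re z)" rule: linorder_cases) auto
      ultimately show "z \<in> (\<lambda>x. Complex x (Y x)) ` J"
        by (intro image_eqI[where x="Re z"]) (simp_all add: complex_eq_iff)
    next
      fix z assume "z \<in> (\<lambda>x. Complex x (Y x)) ` J"
      then obtain x where "x \<in> J" "z = Complex x (Y x)" by blast
      then show "z \<in> {z \<in> S. Im (k z) = v}" using Y by (simp add: S_def)
    qed
    ultimately show ?thesis by simp
  qed
  show "convex_in_direction 0 (k ` S)"
    unfolding convex_in_direction_def
  proof
    fix w
    have "range (\<lambda>t::real. w + of_real t * cis 0) \<inter> k ` S = k ` {z \<in> S. Im (k z) = Im w}"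
    proof (intro equalityI subsetI)
      fix \<zeta> assume "\<zeta> \<in> k ` {z \<in> S. Im (k z) = Im w}"
      then have "\<zeta> \<in> k ` S" "Im \<zeta> = Im w" by auto
      then have "\<zeta> = w + of_real (Re \<zeta> - Re w) * cis 0" by (simp add: complex_eq_iff)
      then show "\<zeta> \<in> range (\<lambda>t::real. w + of_real t * cis 0) \<inter> k ` S" using \<open>\<zeta> \<in> k ` S\<close> by blast
    next
      fix \<zeta> assume "\<zeta> \<in> range (\<lambda>t::real. w + of_real t * cis 0) \<inter> k ` S"
      then obtain t z where z: "z \<in> S" "\<zeta> = k z" and line: "\<zeta> = w + of_real t * cis 0" by blast
      have "Im (k z) = Im w" using arg_cong[OF line, of Im] z(2) by simp
      with z show "\<zeta> \<in> k ` {z \<in> S. Im (k z) = Im w}" by blast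
    qed
    moreover have "connected (k ` {z \<in> S. Im (k z) = Im w})"
      by (intro connected_continuous_image level continuous_on_subset[OF contk]) auto
    ultimately show "connected (range (\<lambda>t::real. w + of_real t * cis 0) \<inter> k ` S)" by simp
  qed
qed

text \<open>
  For \<open>cos \<nu> = \<epsilon> = \<plusminus>1\<close> the kernel is \<open>1 / (1 - \<epsilon> w)\<^sup>2\<close> with primitive \<open>\<kappa> = w / (1 - \<epsilon> w)\<close>, which maps the disc onto
  a half-plane; \<open>Z\<close> is its inverse.  The last claim holds because \<open>Z / q(Z) = \<kappa> (1 + \<epsilon> \<kappa>)\<close>.
\<close>

lemma strip_parametrization_parabolic:
  fixes \<epsilon> :: real
  defines "J \<equiv> {x. - 1 / 2 < \<epsilon> * x}" and "Z \<equiv> \<lambda>\<kappa>. \<kappa> / (1 + of_real \<epsilon> * \<kappa>)"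
  assumes \<epsilon>: "\<epsilon>\<^sup>2 = 1"
  shows "open J" "connected J" "Z ` {\<kappa>. Re \<kappa> \<in> J} = ball 0 1"
    and "\<And>\<kappa>. Re \<kappa> \<in> J \<Longrightarrow> (Z has_field_derivative 1 - 2 * Z \<kappa> * of_real \<epsilon> + (Z \<kappa>)\<^sup>2) (at \<kappa>)"
    and "\<And>\<kappa>. Re \<kappa> \<in> J \<Longrightarrow> Im (Z \<kappa> / (1 - 2 * Z \<kappa> * of_real \<epsilon> + (Z \<kappa>)\<^sup>2)) = (1 + 2 * \<epsilon> * Re \<kappa>) * Im \<kappa>"
proof -
  have \<epsilon>2: "complex_of_real \<epsilon> * of_real \<epsilon> = 1" using \<epsilon> by (simp add: power2_eq_square flip: of_real_mult)
  have "J = (\<lambda>x. \<epsilon> * x) -` {- 1 / 2 <..}" by (auto simp: J_def)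
  then show "open J" by (simp add: continuous_on_mult_left continuous_on_id open_vimage)
  have "convex J"
    unfolding J_def using convex_halfspace_gt[of "- 1 / 2" \<epsilon>] by (simp add: inner_real_def)
  then show "connected J" by (rule convex_connected)
  have nz: "1 + of_real \<epsilon> * \<kappa> \<noteq> 0" if "Re \<kappa> \<in> J" for \<kappa>
  proof
    assume "1 + of_real \<epsilon> * \<kappa> = 0"
    then have "Re (1 + of_real \<epsilon> * \<kappa>) = 0" by simp
    with that show False by (simp add: J_def)
  qed
  have q: "1 - 2 * Z \<kappa> * of_real \<epsilon> + (Z \<kappa>)\<^sup>2 = 1 / (1 + of_real \<epsilon> * \<kappa>)\<^sup>2" if "Re \<kappa> \<in> J" for \<kappa>
  proof -
    define d where "d = 1 + of_real \<epsilon> * \<kappa>"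
    have "(d\<^sup>2 - 2 * \<kappa> * of_real \<epsilon> * d + \<kappa>\<^sup>2) = 1" using \<epsilon>2 unfolding d_def by algebra
    moreover have "d \<noteq> 0" using nz[OF that] by (simp add: d_def)
    ultimately show ?thesis by (simp add: Z_def flip: d_def) (simp add: divide_simps power2_eq_square algebra_simps)
  qed
  have norm: "cmod \<kappa> < cmod (1 + of_real \<epsilon> * \<kappa>) \<longleftrightarrow> Re \<kappa> \<in> J" for \<kappa>
  proof -
    have "(cmod (1 + of_real \<epsilon> * \<kappa>))\<^sup>2 = 1 + 2 * \<epsilon> * Re \<kappa> + \<epsilon>\<^sup>2 * (cmod \<kappa>)\<^sup>2"
      unfolding cmod_power2 by (simp add: algebra_simps power2_eq_square)
    then have "(cmod \<kappa>)\<^sup>2 < (cmod (1 + of_real \<epsilon> * \<kappa>))\<^sup>2 \<longleftrightarrow> Re \<kappa> \<in> J"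
      using \<epsilon> by (auto simp: J_def)
    then show ?thesis by (smt (verit) norm_ge_zero power2_le_imp_le power_mono)
  qed
  show "Z ` {\<kappa>. Re \<kappa> \<in> J} = ball 0 1"
  proof (intro equalityI subsetI)
    fix w assume "w \<in> Z ` {\<kappa>. Re \<kappa> \<in> J}"
    then obtain \<kappa> where "Re \<kappa> \<in> J" "w = Z \<kappa>" by auto
    then show "w \<in> ball 0 1" using norm[of \<kappa>] nz[of \<kappa>] by (simp add: Z_def norm_divide)
  next
    fix w :: complex assume w: "w \<in> ball 0 1"
    have "\<bar>\<epsilon>\<bar> = 1" using \<epsilon> by (auto simp: power2_eq_1_iff)
    then have "cmod (of_real \<epsilon> * w) < 1" using w by (simp add: norm_mult)
    then have nz': "1 - of_real \<epsilon> * w \<noteq> 0" by (metis less_irrefl norm_one right_minus_eq)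
    define \<kappa> where "\<kappa> = w / (1 - of_real \<epsilon> * w)"
    have 1: "1 + of_real \<epsilon> * \<kappa> = 1 / (1 - of_real \<epsilon> * w)" using nz' by (simp add: \<kappa>_def field_simps)
    then have "Z \<kappa> = w" using nz' by (simp add: Z_def \<kappa>_def)
    moreover have "Re \<kappa> \<in> J"
      using w nz' by (simp add: 1 flip: norm) (simp add: \<kappa>_def norm_divide divide_strict_right_mono)
    ultimately show "w \<in> Z ` {\<kappa>. Re \<kappa> \<in> J}" by blast
  qed
  show "(Z has_field_derivative 1 - 2 * Z \<kappa> * of_real \<epsilon> + (Z \<kappa>)\<^sup>2) (at \<kappa>)" if "Re \<kappa> \<in> J" for \<kappa>
    unfolding q[OF that] unfolding Z_def using nz[OF that]
    by (auto intro!: derivative_eq_intros simp: power2_eq_square)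
  show "Im (Z \<kappa> / (1 - 2 * Z \<kappa> * of_real \<epsilon> + (Z \<kappa>)\<^sup>2)) = (1 + 2 * \<epsilon> * Re \<kappa>) * Im \<kappa>" if "Re \<kappa> \<in> J" for \<kappa>
  proof -
    have "Z \<kappa> / (1 - 2 * Z \<kappa> * of_real \<epsilon> + (Z \<kappa>)\<^sup>2) = \<kappa> * (1 + of_real \<epsilon> * \<kappa>)"
      unfolding q[OF that] unfolding Z_def using nz[OF that] by (simp add: power2_eq_square)
    then show ?thesis by (simp add: algebra_simps)
  qed
qed

text \<open>
  The difference of the squared moduli is exactly the product on the right.  This identifies the domain
  on which \<open>sin \<alpha> / sin (\<alpha> + \<nu>)\<close> takes values in the unit disc.
\<close>

lemma cmod_sin_less_cmod_sin_add_iff: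
  "cmod (sin \<alpha>) < cmod (sin (\<alpha> + of_real \<nu>)) \<longleftrightarrow> 0 < sin (2 * Re \<alpha> + \<nu>) * sin \<nu>"
proof -
  have "(cmod (sin (\<alpha> + of_real \<nu>)))\<^sup>2 - (cmod (sin \<alpha>))\<^sup>2 = (cos (2 * Re \<alpha>) - cos (2 * Re \<alpha> + 2 * \<nu>)) / 2"
    by (simp add: norm_sin_squared field_simps)
  also have "\<dots> = sin (2 * Re \<alpha> + \<nu>) * sin \<nu>"
    using cos_diff[of "2 * Re \<alpha> + \<nu>" \<nu>] cos_add[of "2 * Re \<alpha> + \<nu>" \<nu>] by (simp add: field_simps)
  finally have "(cmod (sin \<alpha>))\<^sup>2 < (cmod (sin (\<alpha> + of_real \<nu>)))\<^sup>2 \<longleftrightarrow> 0 < sin (2 * Re \<alpha> + \<nu>) * sin \<nu>"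
    by linarith
  then show ?thesis by (smt (verit) norm_ge_zero power2_le_imp_le power_mono)
qed

text \<open>
  For \<open>sin \<nu> > 0\<close> the primitive of the kernel is
  \<open>(Ln (1 - w e\<^sup>-\<^sup>i\<^sup>\<nu>) - Ln (1 - w e\<^sup>i\<^sup>\<nu>)) / (2 i sin \<nu>)\<close>, which maps the disc onto a vertical strip.  Its
  inverse simplifies to the quotient of sines \<open>Z\<close>, and \<open>sin\<^sup>2 \<nu>\<close> times \<open>Z / q(Z)\<close> is
  \<open>sin (s \<kappa>) sin (s \<kappa> + \<nu>)\<close>, from which its imaginary part can be read off.
\<close>

lemma strip_parametrization_elliptic:
  fixes \<nu> :: real
  defines "s \<equiv> sin \<nu>"
  defines "J \<equiv> {x. 0 < 2 * s * x + \<nu> \<and> 2 * s * x + \<nu> < pi}"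
    and "Z \<equiv> \<lambda>\<kappa>. sin (of_real s * \<kappa>) / sin (of_real s * \<kappa> + of_real \<nu>)"
  assumes \<nu>: "0 < \<nu>" "\<nu> < pi"
  shows "open J" "connected J" "Z ` {\<kappa>. Re \<kappa> \<in> J} = ball 0 1"
    and "\<And>\<kappa>. Re \<kappa> \<in> J \<Longrightarrow> (Z has_field_derivative 1 - 2 * Z \<kappa> * of_real (cos \<nu>) + (Z \<kappa>)\<^sup>2) (at \<kappa>)"
    and "\<And>\<kappa>. Re \<kappa> \<in> J \<Longrightarrow> Im (Z \<kappa> / (1 - 2 * Z \<kappa> * of_real (cos \<nu>) + (Z \<kappa>)\<^sup>2))
           = sin (2 * s * Re \<kappa> + \<nu>) * (exp (2 * s * Im \<kappa>) - exp (- (2 * s * Im \<kappa>))) / (4 * s\<^sup>2)"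
proof -
  have s: "s > 0" using \<nu> by (simp add: s_def sin_gt_zero)
  have "J = (\<lambda>x. 2 * s * x + \<nu>) -` {0<..<pi}" by (auto simp: J_def)
  moreover have "open ((\<lambda>x. 2 * s * x + \<nu>) -` {0<..<pi})"
    by (intro open_vimage continuous_intros open_greaterThanLessThan)
  ultimately show "open J" by simp
  have "J = {(- \<nu>) / (2 * s)<..<(pi - \<nu>) / (2 * s)}" using s by (auto simp: J_def field_simps)
  then show "connected J" by simp
  have norm: "cmod (sin (of_real s * \<kappa>)) < cmod (sin (of_real s * \<kappa> + of_real \<nu>))" if "Re \<kappa> \<in> J" for \<kappa>
    using that s sin_gt_zero[of "2 * s * Re \<kappa> + \<nu>"]
    by (simp add: cmod_sin_less_cmod_sin_add_iff J_def mult.assoc flip: s_def)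
  have nz: "sin (of_real s * \<kappa> + of_real \<nu>) \<noteq> 0" if "Re \<kappa> \<in> J" for \<kappa>
    using norm[OF that] by auto
  have sq: "(sin (\<alpha> + of_real \<nu>))\<^sup>2 - 2 * sin \<alpha> * sin (\<alpha> + of_real \<nu>) * of_real (cos \<nu>) + (sin \<alpha>)\<^sup>2
              = (of_real s)\<^sup>2" for \<alpha> :: complex
  proof -
    have "(sin \<alpha>)\<^sup>2 + (cos \<alpha>)\<^sup>2 = 1" "(sin (of_real \<nu> :: complex))\<^sup>2 + (cos (of_real \<nu>))\<^sup>2 = 1" by simp_all
    then show ?thesis unfolding sin_add s_def sin_of_real[symmetric] cos_of_real[symmetric] by algebra
  qed
  have q: "1 - 2 * Z \<kappa> * of_real (cos \<nu>) + (Z \<kappa>)\<^sup>2 = (of_real s / sin (of_real s * \<kappa> + of_real \<nu>))\<^sup>2"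
    if "Re \<kappa> \<in> J" for \<kappa>
  proof -
    have "1 - 2 * (x / y) * c + (x / y)\<^sup>2 = (y\<^sup>2 - 2 * x * y * c + x\<^sup>2) / y\<^sup>2" if "y \<noteq> 0" for x y c :: complex
      using that by (simp add: divide_simps) (simp add: algebra_simps power2_eq_square)
    from this[OF nz[OF that], of "sin (of_real s * \<kappa>)" "of_real (cos \<nu>)"]
    show ?thesis unfolding Z_def sq by (simp only: power_divide)
  qed
  show "(Z has_field_derivative 1 - 2 * Z \<kappa> * of_real (cos \<nu>) + (Z \<kappa>)\<^sup>2) (at \<kappa>)" if "Re \<kappa> \<in> J" for \<kappa>
  proof -
    define \<alpha> where "\<alpha> = of_real s * \<kappa>"
    have "sin (\<alpha> + of_real \<nu>) * cos \<alpha> - cos (\<alpha> + of_real \<nu>) * sin \<alpha> = of_real s"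
      using sin_diff[of "\<alpha> + of_real \<nu>" \<alpha>] by (simp add: s_def sin_of_real)
    moreover have "cos \<alpha> * of_real s * sin (\<alpha> + of_real \<nu>) - sin \<alpha> * (cos (\<alpha> + of_real \<nu>) * of_real s)
        = of_real s * (sin (\<alpha> + of_real \<nu>) * cos \<alpha> - cos (\<alpha> + of_real \<nu>) * sin \<alpha>)"
      by (simp only: right_diff_distrib mult_ac)
    ultimately have *: "cos \<alpha> * of_real s * sin (\<alpha> + of_real \<nu>) - sin \<alpha> * (cos (\<alpha> + of_real \<nu>) * of_real s) = (of_real s)\<^sup>2"
      by (simp only: power2_eq_square)
    have "(Z has_field_derivative (cos \<alpha> * of_real s * sin (\<alpha> + of_real \<nu>) - sin \<alpha> * (cos (\<alpha> + of_real \<nu>) * of_real s))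
             / (sin (\<alpha> + of_real \<nu>) * sin (\<alpha> + of_real \<nu>))) (at \<kappa>)"
      using nz[OF that] unfolding Z_def \<alpha>_def by (auto intro!: derivative_eq_intros)
    then show ?thesis unfolding * q[OF that] by (simp add: \<alpha>_def power_divide power2_eq_square)
  qed
  show "Im (Z \<kappa> / (1 - 2 * Z \<kappa> * of_real (cos \<nu>) + (Z \<kappa>)\<^sup>2))
           = sin (2 * s * Re \<kappa> + \<nu>) * (exp (2 * s * Im \<kappa>) - exp (- (2 * s * Im \<kappa>))) / (4 * s\<^sup>2)"
    if "Re \<kappa> \<in> J" for \<kappa>
  proof -
    define \<alpha> where "\<alpha> = of_real s * \<kappa>"
    have "Z \<kappa> / (1 - 2 * Z \<kappa> * of_real (cos \<nu>) + (Z \<kappa>)\<^sup>2) = sin \<alpha> * sin (\<alpha> + of_real \<nu>) / (of_real s)\<^sup>2"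
      unfolding q[OF that] unfolding Z_def using nz[OF that] s by (simp add: \<alpha>_def divide_simps power2_eq_square)
    also have "sin \<alpha> * sin (\<alpha> + of_real \<nu>) = (cos (of_real \<nu>) - cos (2 * \<alpha> + of_real \<nu>)) / 2"
      using sin_times_sin[of "\<alpha> + of_real \<nu>" \<alpha>] by (simp add: algebra_simps)
    also have "(cos (of_real \<nu>) - cos (2 * \<alpha> + of_real \<nu>)) / 2 / (of_real s)\<^sup>2
        = (of_real (cos \<nu>) - cos (2 * \<alpha> + of_real \<nu>)) / of_real (2 * s\<^sup>2)"
      by (simp add: cos_of_real)
    finally show ?thesis
      by (simp only: Im_divide_of_real) (simp add: Im_cos \<alpha>_def mult.assoc right_diff_distrib diff_divide_distrib)
  qed
  show "Z ` {\<kappa>. Re \<kappa> \<in> J} = ball 0 1"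
  proof (intro equalityI subsetI)
    fix w assume "w \<in> Z ` {\<kappa>. Re \<kappa> \<in> J}"
    then obtain \<kappa> where "Re \<kappa> \<in> J" "w = Z \<kappa>" by auto
    then show "w \<in> ball 0 1" using norm[of \<kappa>] nz[of \<kappa>] by (simp add: Z_def norm_divide)
  next
    fix w :: complex assume w: "w \<in> ball 0 1"
    define E where "E = cis \<nu>"
    have nz1: "1 - w * E \<noteq> 0" and nz2: "1 - w / E \<noteq> 0"
    proof -
      have "cmod (w * E) < 1" "cmod (w / E) < 1" using w by (simp_all add: E_def norm_mult norm_divide)
      then show "1 - w * E \<noteq> 0" "1 - w / E \<noteq> 0" by (metis less_irrefl norm_one right_minus_eq)+
    qed
    define T where "T = (1 - w / E) / (1 - w * E)"
    have "T \<noteq> 0" using nz1 nz2 by (simp add: T_def)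
    \<comment> \<open>The equation \<open>w = sin \<alpha> / sin (\<alpha> + \<nu>)\<close> is equivalent to \<open>e\<^sup>2\<^sup>i\<^sup>\<alpha> = T\<close>.  The principal logarithm is the right
      branch: it puts \<open>2 Re \<alpha> + \<nu>\<close> into \<open>(-\<pi>, 2 \<pi>)\<close>, where a positive sine forces \<open>(0, \<pi>)\<close>.\<close>
    define \<alpha> where "\<alpha> = - \<i> * Ln T / 2"
    have Re\<alpha>: "- pi < 2 * Re \<alpha>" "2 * Re \<alpha> \<le> pi" using \<open>T \<noteq> 0\<close> mpi_less_Im_Ln Im_Ln_le_pi by (auto simp: \<alpha>_def)
    have e2: "exp (\<i> * \<alpha>) * exp (\<i> * \<alpha>) = T" 
      using \<open>T \<noteq> 0\<close> by (simp add: \<alpha>_def flip: exp_add)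
    have E: "E \<noteq> 0" "exp (\<i> * of_real \<nu>) = E" by (simp_all add: E_def cis_conv_exp)
    have "sin \<alpha> = w * sin (\<alpha> + of_real \<nu>)"
    proof -
      define e where "e = exp (\<i> * \<alpha>)"
      have "e \<noteq> 0" by (simp add: e_def)
      have "e * e * (1 - w * E) = 1 - w / E" using e2 nz1 by (simp add: T_def e_def)
      then have "e * e - 1 = w * (e * e * E - 1 / E)" by (simp add: algebra_simps)
      moreover have "(e - 1 / e) * e = e * e - 1" "(w * (e * E - 1 / (e * E))) * e = w * (e * e * E - 1 / E)"
        using \<open>e \<noteq> 0\<close> by (simp_all add: algebra_simps)
      ultimately have "(e - 1 / e) * e = (w * (e * E - 1 / (e * E))) * e" by (simp only:)
      then have *: "e - 1 / e = w * (e * E - 1 / (e * E))" using \<open>e \<noteq> 0\<close> by simp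
      have sin_eq: "sin x = (exp (\<i> * x) - 1 / exp (\<i> * x)) / (2 * \<i>)" for x
        by (simp add: sin_exp_eq' exp_minus field_simps)
      have "exp (\<i> * (\<alpha> + of_real \<nu>)) = e * E" by (simp add: distrib_left exp_add E(2) e_def)
      with * show ?thesis by (simp add: sin_eq flip: e_def)
    qed
    moreover have "sin (\<alpha> + of_real \<nu>) \<noteq> 0"
    proof
      assume 0: "sin (\<alpha> + of_real \<nu>) = 0"
      then have "sin \<alpha> = 0" using calculation by simp
      with 0 s have "cos \<alpha> = 0" by (simp add: sin_add s_def sin_of_real)
      with \<open>sin \<alpha> = 0\<close> show False using sin_cos_squared_add[of \<alpha>] by simp
    qed
    ultimately have w_eq: "w = sin \<alpha> / sin (\<alpha> + of_real \<nu>)" by simp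
    with w \<open>sin (\<alpha> + of_real \<nu>) \<noteq> 0\<close> have "cmod (sin \<alpha>) < cmod (sin (\<alpha> + of_real \<nu>))"
      by (simp add: norm_divide)
    with s have pos: "0 < sin (2 * Re \<alpha> + \<nu>)"
      by (simp add: cmod_sin_less_cmod_sin_add_iff zero_less_mult_iff flip: s_def)
    have "0 < 2 * Re \<alpha> + \<nu>"
      using pos sin_ge_zero[of "- (2 * Re \<alpha> + \<nu>)"] Re\<alpha> \<nu> by (smt (verit) sin_minus)
    moreover have "2 * Re \<alpha> + \<nu> < pi"
      using pos sin_le_zero[of "2 * Re \<alpha> + \<nu>"] Re\<alpha> \<nu> by linarith
    ultimately have "Re (\<alpha> / of_real s) \<in> J" using s by (simp add: J_def)
    moreover have "Z (\<alpha> / of_real s) = w" using s w_eq by (simp add: Z_def)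
    ultimately show "w \<in> Z ` {\<kappa>. Re \<kappa> \<in> J}" by blast
  qed
qed

text \<open>
  A conformal coordinate \<open>\<kappa>\<close> on the disc with \<open>dw / d\<kappa> = q(w)\<close>, in which \<open>w / q(w)\<close> has imaginary part tending to
  \<open>\<plusminus>\<infinity>\<close> at the two ends of every vertical line.  Only \<open>cos \<nu>\<close> enters, so \<open>\<nu>\<close> may be moved into
  \<open>[0, \<pi>]\<close>.
\<close>

lemma strip_parametrization:
  fixes \<nu> :: real
  obtains J Z where "open J" "connected J" "Z ` {\<kappa>. Re \<kappa> \<in> J} = ball 0 1"
    "\<And>\<kappa>. Re \<kappa> \<in> J \<Longrightarrow> (Z has_field_derivative 1 - 2 * Z \<kappa> * of_real (cos \<nu>) + (Z \<kappa>)\<^sup>2) (at \<kappa>)"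
    "\<And>x. x \<in> J \<Longrightarrow>
       filterlim (\<lambda>y. Im (Z (Complex x y) / (1 - 2 * Z (Complex x y) * of_real (cos \<nu>) + (Z (Complex x y))\<^sup>2))) at_top at_top"
    "\<And>x. x \<in> J \<Longrightarrow>
       filterlim (\<lambda>y. Im (Z (Complex x y) / (1 - 2 * Z (Complex x y) * of_real (cos \<nu>) + (Z (Complex x y))\<^sup>2))) at_bot at_bot"
proof (cases "sin \<nu> = 0")
  case True
  then have \<epsilon>: "(cos \<nu>)\<^sup>2 = 1" using sin_cos_squared_add[of \<nu>] by simp
  note * = strip_parametrization_parabolic[OF \<epsilon>]
  show ?thesis
  proof (rule that[OF *(1-4)])
    fix x assume x: "x \<in> {x. - 1 / 2 < cos \<nu> * x}"
    let ?Z = "\<lambda>\<kappa>. \<kappa> / (1 + of_real (cos \<nu>) * \<kappa>)"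
    have eq: "Im (?Z (Complex x y) / (1 - 2 * ?Z (Complex x y) * of_real (cos \<nu>) + (?Z (Complex x y))\<^sup>2))
      = (1 + 2 * cos \<nu> * x) * y" for y
      using *(5)[of "Complex x y"] x by simp
    have c: "1 + 2 * cos \<nu> * x > 0" using x by simp
    show "filterlim (\<lambda>y. Im (?Z (Complex x y) / (1 - 2 * ?Z (Complex x y) * of_real (cos \<nu>) + (?Z (Complex x y))\<^sup>2))) at_top at_top"
      unfolding eq using c by real_asymp
    show "filterlim (\<lambda>y. Im (?Z (Complex x y) / (1 - 2 * ?Z (Complex x y) * of_real (cos \<nu>) + (?Z (Complex x y))\<^sup>2))) at_bot at_bot"
      unfolding eq using c by real_asymp
  qed
next
  case False
  define \<nu>' where "\<nu>' = arccos (cos \<nu>)"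
  have cos: "cos \<nu>' = cos \<nu>" by (simp add: \<nu>'_def cos_arccos)
  have "sin \<nu>' \<noteq> 0" using False sin_squared_eq[of \<nu>] sin_squared_eq[of \<nu>'] by (auto simp: cos)
  moreover have "0 \<le> \<nu>'" "\<nu>' \<le> pi" by (simp_all add: \<nu>'_def arccos_lbound arccos_ubound)
  ultimately have \<nu>': "0 < \<nu>'" "\<nu>' < pi" by (auto simp: less_le)
  note * = strip_parametrization_elliptic[OF \<nu>', unfolded cos]
  show ?thesis
  proof (rule that[OF *(1-4)])
    fix x assume x: "x \<in> {x. 0 < 2 * sin \<nu>' * x + \<nu>' \<and> 2 * sin \<nu>' * x + \<nu>' < pi}"
    let ?Z = "\<lambda>\<kappa>. sin (of_real (sin \<nu>') * \<kappa>) / sin (of_real (sin \<nu>') * \<kappa> + of_real \<nu>')"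
    define s where "s = sin \<nu>'"
    define C where "C = sin (2 * s * x + \<nu>') / (4 * s\<^sup>2)"
    have eq: "Im (?Z (Complex x y) / (1 - 2 * ?Z (Complex x y) * of_real (cos \<nu>) + (?Z (Complex x y))\<^sup>2))
      = C * (exp (2 * s * y) - exp (- (2 * s * y)))" for y
      using *(5)[of "Complex x y"] x by (simp add: C_def s_def)
    have s: "s > 0" using \<nu>' by (simp add: s_def sin_gt_zero)
    have C: "C > 0" using x s unfolding C_def by (auto intro!: divide_pos_pos sin_gt_zero simp: s_def)
    show "filterlim (\<lambda>y. Im (?Z (Complex x y) / (1 - 2 * ?Z (Complex x y) * of_real (cos \<nu>) + (?Z (Complex x y))\<^sup>2))) at_top at_top"
      unfolding eq using s C by real_asymp
    show "filterlim (\<lambda>y. Im (?Z (Complex x y) / (1 - 2 * ?Z (Complex x y) * of_real (cos \<nu>) + (?Z (Complex x y))\<^sup>2))) at_bot at_bot"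
      unfolding eq using s C by real_asymp
  qed
qed

text \<open>
  Here \<open>Re ((1 - w\<^sup>2) cnj q) = (1 - |w|\<^sup>2) (1 + |w|\<^sup>2 - 2 c Re w)\<close>.  For \<open>c = cos \<nu>\<close> the quotient is
  the average of the half-plane functions \<open>(1 + w e\<^sup>\<plusminus>\<^sup>i\<^sup>\<nu>) / (1 - w e\<^sup>\<plusminus>\<^sup>i\<^sup>\<nu>)\<close>.
\<close>

lemma quadratic_factor_positive:
  fixes w :: complex and c :: real
  assumes w: "cmod w < 1" and c: "\<bar>c\<bar> \<le> 1"
  defines "q \<equiv> 1 - 2 * w * of_real c + w\<^sup>2"
  shows "q \<noteq> 0" "Re ((1 - w\<^sup>2) / q) > 0"
proof -
  have "Re ((1 - w\<^sup>2) * cnj q) = (1 - (cmod w)\<^sup>2) * (1 + (cmod w)\<^sup>2 - 2 * c * Re w)"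
    unfolding q_def cmod_power2 by (simp add: algebra_simps power2_eq_square)
  moreover have "1 + (cmod w)\<^sup>2 - 2 * c * Re w > 0"
  proof -
    have "c * Re w \<le> \<bar>c\<bar> * \<bar>Re w\<bar>" by (metis abs_ge_self abs_mult)
    also have "\<dots> \<le> 1 * cmod w" using c abs_Re_le_cmod[of w] by (intro mult_mono) auto
    finally have "1 + (cmod w)\<^sup>2 - 2 * c * Re w \<ge> (1 - cmod w)\<^sup>2" by (simp add: power2_eq_square algebra_simps)
    moreover have "(1 - cmod w)\<^sup>2 > 0" using w by simp
    ultimately show ?thesis by linarith
  qed
  moreover have "1 - (cmod w)\<^sup>2 > 0" using w by (simp add: abs_square_less_1)
  ultimately have "Re ((1 - w\<^sup>2) * cnj q) > 0" by simp
  then show "q \<noteq> 0" "Re ((1 - w\<^sup>2) / q) > 0" by (auto simp only: Re_complex_div_gt_0)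
     auto
qed

text \<open>
  A case of the Royster--Ziegler criterion.  In the coordinate \<open>\<kappa>\<close> the derivative of \<open>\<Psi>\<close> is
  \<open>A' q + C (1 - w\<^sup>2) / q\<close>, both summands having positive real part.  The imaginary part of \<open>A\<close> is monotone on
  the vertical lines of this coordinate, so it cannot compensate the divergence of \<open>C Im (w / q)\<close>, and
  \<open>horizontally_convex_image_of_strip\<close> applies.
\<close>

lemma horizontally_convex_of_kernel:
  fixes \<nu> C :: real and A :: "complex \<Rightarrow> complex"
  defines "q \<equiv> \<lambda>w. 1 - 2 * w * of_real (cos \<nu>) + w\<^sup>2"
  defines "\<Psi> \<equiv> \<lambda>w. A w + of_real C * (w / q w)"
  assumes A: "A holomorphic_on ball 0 1" and pos: "\<And>w. w \<in> ball 0 1 \<Longrightarrow> Re (deriv A w * q w) > 0"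
    and C: "C > 0"
  shows "inj_on \<Psi> (ball 0 1)" "convex_in_direction 0 (\<Psi> ` ball 0 1)"
proof -
  have q_eq: "1 - 2 * w * of_real (cos \<nu>) + w\<^sup>2 = q w" for w by (simp add: q_def)
  obtain J Z where J: "open J" "connected J" and Z_image: "Z ` {\<kappa>. Re \<kappa> \<in> J} = ball 0 1"
    and dZ: "\<And>\<kappa>. Re \<kappa> \<in> J \<Longrightarrow> (Z has_field_derivative q (Z \<kappa>)) (at \<kappa>)"
    and top: "\<And>x. x \<in> J \<Longrightarrow> filterlim (\<lambda>y. Im (Z (Complex x y) / q (Z (Complex x y)))) at_top at_top"
    and bot: "\<And>x. x \<in> J \<Longrightarrow> filterlim (\<lambda>y. Im (Z (Complex x y) / q (Z (Complex x y)))) at_bot at_bot"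
    by (rule strip_parametrization[of \<nu>, unfolded q_eq], rule that)
  have Z_ball: "Z \<kappa> \<in> ball 0 1" if "Re \<kappa> \<in> J" for \<kappa> using Z_image that by blast
  have q: "q w \<noteq> 0" "Re ((1 - w\<^sup>2) / q w) > 0" if "w \<in> ball 0 1" for w
    using quadratic_factor_positive[of w "cos \<nu>"] that by (simp_all add: q_def)
  define k where "k \<kappa> = \<Psi> (Z \<kappa>)" for \<kappa>
  have dAZ: "((\<lambda>\<kappa>. A (Z \<kappa>)) has_field_derivative deriv A (Z \<kappa>) * q (Z \<kappa>)) (at \<kappa>)" if "Re \<kappa> \<in> J" for \<kappa>
    using DERIV_chain2[where f=A and g=Z and x=\<kappa>, OF holomorphic_derivI[OF A open_ball Z_ball[OF that]] dZ[OF that]] .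
  have dk: "(k has_field_derivative deriv A (Z \<kappa>) * q (Z \<kappa>) + of_real C * ((1 - (Z \<kappa>)\<^sup>2) / q (Z \<kappa>))) (at \<kappa>)"
    if "Re \<kappa> \<in> J" for \<kappa>
  proof -
    define w where "w = Z \<kappa>"
    have w: "q w \<noteq> 0" using q(1) Z_ball[OF that] by (simp add: w_def)
    have "((\<lambda>w. w / q w) has_field_derivative (q w - w * (2 * w - 2 * of_real (cos \<nu>))) / (q w * q w)) (at w)"
      using w unfolding q_def by (auto intro!: derivative_eq_intros)
    also have "q w - w * (2 * w - 2 * of_real (cos \<nu>)) = 1 - w\<^sup>2"
      by (simp add: q_def algebra_simps power2_eq_square)
    finally have dq: "((\<lambda>w. w / q w) has_field_derivative (1 - w\<^sup>2) / (q w * q w)) (at w)" .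
    have "((\<lambda>\<kappa>. Z \<kappa> / q (Z \<kappa>)) has_field_derivative (1 - w\<^sup>2) / (q w * q w) * q w) (at \<kappa>)"
      using DERIV_chain2[where f="\<lambda>w. w / q w" and g=Z and x=\<kappa>, OF dq[unfolded w_def] dZ[OF that]]
      unfolding w_def .
    also have "(1 - w\<^sup>2) / (q w * q w) * q w = (1 - w\<^sup>2) / q w" using w by simp
    finally have "((\<lambda>\<kappa>. Z \<kappa> / q (Z \<kappa>)) has_field_derivative (1 - w\<^sup>2) / q w) (at \<kappa>)" .
    then show ?thesis
      unfolding k_def[abs_def] \<Psi>_def w_def by (intro DERIV_add DERIV_cmult dAZ that)
  qed
  have Im_k: "Im (k \<kappa>) = Im (A (Z \<kappa>)) + C * Im (Z \<kappa> / q (Z \<kappa>))" for \<kappa>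
    by (simp add: k_def \<Psi>_def del: Im_divide times_divide_eq_right)
  have Im_A_mono: "Im (A (Z (Complex x y1))) \<le> Im (A (Z (Complex x y2)))" if x: "x \<in> J" and "y1 \<le> y2" for x y1 y2
  proof (rule DERIV_nonneg_imp_nondecreasing[OF \<open>y1 \<le> y2\<close>, of "\<lambda>y. Im (A (Z (Complex x y)))"])
    fix y :: real
    let ?\<kappa> = "of_real x + \<i> * of_real y"
    have \<kappa>: "Re ?\<kappa> \<in> J" using x by simp
    have "((\<lambda>\<xi>. A (Z (of_real x + \<i> * \<xi>))) has_field_derivative deriv A (Z ?\<kappa>) * q (Z ?\<kappa>) * \<i>) (at (of_real y))"
      by (rule DERIV_chain2[where f="\<lambda>\<kappa>. A (Z \<kappa>)" and g="\<lambda>\<xi>. of_real x + \<i> * \<xi>" and x="of_real y", OF dAZ[OF \<kappa>]])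
        (auto intro!: derivative_eq_intros)
    from has_real_derivative_Im[OF this]
    have "((\<lambda>y. Im (A (Z (Complex x y)))) has_real_derivative Re (deriv A (Z ?\<kappa>) * q (Z ?\<kappa>))) (at y)"
      by (simp add: Complex_eq)
    then show "\<exists>d. ((\<lambda>y. Im (A (Z (Complex x y)))) has_real_derivative d) (at y) \<and> 0 \<le> d"
      using pos[OF Z_ball[OF \<kappa>]] by (intro exI conjI) (auto intro: less_imp_le)
  qed
  have k_hol: "k holomorphic_on {\<kappa>. Re \<kappa> \<in> J}"
  proof -
    have "{\<kappa>. Re \<kappa> \<in> J} = Re -` J" by auto
    then have "open {\<kappa>. Re \<kappa> \<in> J}" using open_vimage[OF J(1) continuous_on_Re[OF continuous_on_id]] by simp
    then show ?thesis using dk by (auto simp: holomorphic_on_open)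
  qed
  have k_pos: "Re (deriv k \<kappa>) > 0" if "\<kappa> \<in> {\<kappa>. Re \<kappa> \<in> J}" for \<kappa>
  proof -
    from that show ?thesis using q(2)[OF Z_ball, of \<kappa>] pos[OF Z_ball, of \<kappa>] C DERIV_imp_deriv[OF dk, of \<kappa>]
      by (auto intro!: add_pos_pos mult_pos_pos simp del: Re_divide times_divide_eq_right)
  qed
  have k_top: "filterlim (\<lambda>y. Im (k (Complex x y))) at_top at_top" if x: "x \<in> J" for x
  proof -
    have "Im (A (Z (Complex x 0))) + C * Im (Z (Complex x y) / q (Z (Complex x y))) \<le> Im (k (Complex x y))" if "0 \<le> y" for y
      using Im_A_mono[OF x that] by (simp add: Im_k)
    then have ev: "\<forall>\<^sub>F y in at_top. Im (A (Z (Complex x 0))) + C * Im (Z (Complex x y) / q (Z (Complex x y))) \<le> Im (k (Complex x y))"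
      using eventually_ge_at_top[of "0::real"] by (rule eventually_mono[rotated])
    show ?thesis
      by (rule filterlim_at_top_mono[OF _ ev])
         (intro filterlim_tendsto_add_at_top[OF tendsto_const] filterlim_tendsto_pos_mult_at_top[OF tendsto_const C] top x)
  qed
  have k_bot: "filterlim (\<lambda>y. Im (k (Complex x y))) at_bot at_bot" if x: "x \<in> J" for x
  proof -
    have "Im (k (Complex x y)) \<le> Im (A (Z (Complex x 0))) + C * Im (Z (Complex x y) / q (Z (Complex x y)))" if "y \<le> 0" for y
      using Im_A_mono[OF x that] by (simp add: Im_k)
    then have ev: "\<forall>\<^sub>F y in at_bot. Im (k (Complex x y)) \<le> Im (A (Z (Complex x 0))) + C * Im (Z (Complex x y) / q (Z (Complex x y)))"
      using eventually_le_at_bot[of "0::real"] by (rule eventually_mono[rotated])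
    have "filterlim (\<lambda>y. Im (A (Z (Complex x 0))) + C * Im (Z (Complex x y) / q (Z (Complex x y)))) at_bot at_bot"
      unfolding filterlim_tendsto_add_at_bot_iff[OF tendsto_const]
      by (intro filterlim_tendsto_pos_mult_at_bot[OF tendsto_const C] bot x)
    with ev show ?thesis
      by (auto simp: filterlim_at_bot elim: eventually_elim2 intro: order_trans)
  qed
  note k = horizontally_convex_image_of_strip[OF J k_hol k_pos k_top k_bot]
  show "inj_on \<Psi> (ball 0 1)"
    using k(1) unfolding Z_image[symmetric] by (auto simp: inj_on_def k_def)
  show "convex_in_direction 0 (\<Psi> ` ball 0 1)"
    using k(2) by (simp add: k_def[abs_def] image_image flip: Z_image)
qed

section \<open>The dilatation estimate\<close>

text \<open>
  On the circle \<open>|u| = r\<close> the extremal point is \<open>u = r\<close>; the difference of the two sides is a positive multiple of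
  \<open>(r - Re u) (1 - r)\<close>.
\<close>

lemma Re_divide_one_plus_le:
  assumes "cmod u < 1"
  shows "Re (u / (1 + u)) \<le> cmod u / (1 + cmod u)"
proof -
  define r x where "r = cmod u" and "x = Re u"
  have r: "0 \<le> r" "r < 1" and x: "\<bar>x\<bar> \<le> r" using assms abs_Re_le_cmod by (auto simp: r_def x_def)
  have r2: "r\<^sup>2 = (Re u)\<^sup>2 + (Im u)\<^sup>2" by (simp add: r_def cmod_power2)
  have d: "1 + 2 * x + r\<^sup>2 = (cmod (1 + u))\<^sup>2"
    unfolding r_def x_def cmod_power2 by (simp add: algebra_simps power2_eq_square)
  have "1 + u \<noteq> 0" using assms by (metis add_eq_0_iff less_irrefl norm_minus_cancel norm_one)
  then have pos: "1 + 2 * x + r\<^sup>2 > 0" by (simp add: d)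
  have "Re (u / (1 + u)) = (x + r\<^sup>2) / (1 + 2 * x + r\<^sup>2)"
    unfolding d Re_divide' by (simp add: x_def r2) (simp add: power2_eq_square algebra_simps)
  also have "\<dots> \<le> r / (1 + r)"
  proof -
    have "r * (1 + 2 * x + r\<^sup>2) - (x + r\<^sup>2) * (1 + r) = (r - x) * (1 - r)"
      by (simp add: algebra_simps power2_eq_square)
    moreover have "(r - x) * (1 - r) \<ge> 0" using r x by simp
    ultimately show ?thesis using pos r by (simp add: frac_le_eq divide_le_0_iff)
  qed
  finally show ?thesis by (simp add: r_def)
qed

text \<open>
  With \<open>r = |u|\<close>, \<open>m = n - 2\<close> and \<open>A = X + i Y\<close>, the difference \<open>|A|\<^sup>2 - r\<^sup>2 |A + m|\<^sup>2\<close> equals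
  \<open>(X (1 - r) - m r) (X (1 + r) + m r) + (1 - r\<^sup>2) Y\<^sup>2\<close>.  Both linear factors are positive because
  \<open>X > 1 - n r / (1 + r)\<close>: for the first factor this is the quadratic condition on \<open>r\<close>, and the second
  exceeds \<open>1 - r\<close>.
\<close>

lemma dilatation_estimate:
  fixes u p :: complex and n :: nat
  assumes p: "Re p > 0" and u: "cmod u < 1" 
    and cond: "0 \<le> 1 - 2 * (real n - 1) * cmod u + (cmod u)\<^sup>2"
  defines "A \<equiv> 1 + p - of_nat n * u / (1 + u)"
  shows "cmod (u * (A + of_nat n - 2)) < cmod A"
proof -
  define r m X Y where "r = cmod u" and "m = real n - 2" and "X = Re A" and "Y = Im A"
  have r: "0 \<le> r" "r < 1" using u by (auto simp: r_def)
  have "real n * Re (u / (1 + u)) \<le> real n * (r / (1 + r))"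
    using Re_divide_one_plus_le[OF u] unfolding r_def by (intro mult_left_mono) auto
  moreover have "X = 1 + Re p - real n * Re (u / (1 + u))"
  proof -
    have "Re (of_nat n * v) = real n * Re v" for v by simp
    from this[of "u / (1 + u)"] show ?thesis by (simp add: X_def A_def del: Re_divide)
  qed
  ultimately have X: "X * (1 + r) > 1 + r - real n * r"
  proof -
    assume a: "real n * Re (u / (1 + u)) \<le> real n * (r / (1 + r))" and "X = 1 + Re p - real n * Re (u / (1 + u))"
    then have "X > 1 - real n * (r / (1 + r))" using p by linarith
    then have "X * (1 + r) > (1 - real n * (r / (1 + r))) * (1 + r)" using r by (intro mult_strict_right_mono) auto
    also have "(1 - real n * (r / (1 + r))) * (1 + r) = 1 + r - real n * r" using r by (simp add: field_simps)
    finally show ?thesis .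
  qed
  have 1: "X * (1 - r) - m * r > 0"
  proof -
    have "(X * (1 - r) - m * r) * (1 + r) = (X * (1 + r)) * (1 - r) - m * r * (1 + r)"
      by (simp add: algebra_simps)
    also have "\<dots> > (1 + r - real n * r) * (1 - r) - m * r * (1 + r)"
      using X r by (intro diff_strict_right_mono mult_strict_right_mono) auto
    also have "(1 + r - real n * r) * (1 - r) - m * r * (1 + r) = 1 - 2 * (real n - 1) * r + r\<^sup>2"
      by (simp add: m_def algebra_simps power2_eq_square)
    finally have "(X * (1 - r) - m * r) * (1 + r) > 0" using cond unfolding r_def by linarith
    then show ?thesis using r by (simp add: zero_less_mult_iff)
  qed
  have 2: "X * (1 + r) + m * r > 0"
    using X r by (simp add: m_def algebra_simps)
  have "(cmod A)\<^sup>2 - (cmod (u * (A + of_nat n - 2)))\<^sup>2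
      = (X * (1 - r) - m * r) * (X * (1 + r) + m * r) + (1 - r\<^sup>2) * Y\<^sup>2"
    unfolding norm_mult power_mult_distrib r_def[symmetric] unfolding cmod_power2
    by (simp add: X_def Y_def m_def) (simp add: algebra_simps power2_eq_square)
  also have "\<dots> > 0"
  proof (rule add_pos_nonneg)
    show "(X * (1 - r) - m * r) * (X * (1 + r) + m * r) > 0" using 1 2 by (rule mult_pos_pos)
    show "(1 - r\<^sup>2) * Y\<^sup>2 \<ge> 0" using r by (simp add: power_le_one)
  qed
  finally show ?thesis by (simp add: power2_less_imp_less)
qed

section \<open>Convolution with the half-plane mapping\<close>

lemma fps_expansion_eq_Abs_fps:
  fixes f :: "complex \<Rightarrow> complex"
  assumes "\<And>z. z \<in> ball 0 1 \<Longrightarrow> (\<lambda>n. c n * z ^ n) sums f z"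
  shows "fps_expansion f 0 = Abs_fps c"
proof (rule fps_expansion_eqI, rule has_fps_expansionI)
  have "\<forall>\<^sub>F z in nhds (0::complex). z \<in> ball 0 1" by (intro eventually_nhds_in_open) auto
  then show "\<forall>\<^sub>F z in nhds 0. (\<lambda>n. fps_nth (Abs_fps c) n * z ^ n) sums f z"
    by eventually_elim (simp add: assms)
qed

lemma half_plane_series:
  fixes z :: complex
  assumes "z \<in> ball 0 1"
  shows "(\<lambda>n. (if n = 0 then 0 else 1) * z ^ n) sums (z / (1 - z))"
    and "(\<lambda>n. of_nat n * z ^ n) sums (z / (1 - z)\<^sup>2)"
proof -
  have z: "norm z < 1" "z \<noteq> 1" using assms by auto
  have "(\<lambda>n. z * z ^ n) sums (z * (1 / (1 - z)))" by (intro sums_mult geometric_sums z)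
  then have "(\<lambda>n. (if Suc n = 0 then 0 else 1) * z ^ Suc n) sums (z / (1 - z))" by simp
  then show "(\<lambda>n. (if n = 0 then 0 else 1) * z ^ n) sums (z / (1 - z))" by (subst (asm) sums_Suc_iff) simp
  have "(\<lambda>n. z * (of_nat (Suc n) * z ^ n)) sums (z * (1 / (1 - z)\<^sup>2))" by (intro sums_mult geometric_deriv_sums z)
  then have "(\<lambda>n. of_nat (Suc n) * z ^ Suc n) sums (z / (1 - z)\<^sup>2)" by (simp add: mult_ac)
  then show "(\<lambda>n. of_nat n * z ^ n) sums (z / (1 - z)\<^sup>2)" by (subst (asm) sums_Suc_iff) simp
qed

text \<open>
  The factor \<open>\<phi>\<close> has the coefficients \<open>(1 + \<sigma> k) / 2\<close> for \<open>k \<ge> 1\<close>, and multiplying the \<open>k\<close>-th coefficient of \<open>h\<close> by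
  \<open>k\<close> amounts to applying \<open>z d/dz\<close>; the exception at \<open>k = 0\<close> is absorbed by \<open>h 0 = 0\<close>.  The parameter \<open>\<sigma> = \<plusminus>1\<close> covers both parts of the half-plane
  mapping.
\<close>

lemma conv_half_plane:
  fixes \<phi> h :: "complex \<Rightarrow> complex" and \<sigma> :: complex
  assumes \<phi>: "\<And>z. z \<in> ball 0 1 \<Longrightarrow> \<phi> z = 1/2 * (z / (1 - z) + \<sigma> * (z / (1 - z)\<^sup>2))"
    and h: "h holomorphic_on ball 0 1" "h 0 = 0" and z: "z \<in> ball 0 1"
  shows "conv \<phi> h z = (h z + \<sigma> * (z * deriv h z)) / 2"
proof -
  define c :: "nat \<Rightarrow> complex" where "c n = 1/2 * ((if n = 0 then 0 else 1) + \<sigma> * of_nat n)" for n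
  define b where "b n = (deriv ^^ n) h 0 / fact n" for n
  have "fps_expansion \<phi> 0 = Abs_fps c"
  proof (rule fps_expansion_eq_Abs_fps)
    fix z :: complex assume z: "z \<in> ball 0 1"
    have "(\<lambda>n. 1/2 * ((if n = 0 then 0 else 1) * z ^ n + \<sigma> * (of_nat n * z ^ n))) sums \<phi> z"
      unfolding \<phi>[OF z] by (intro sums_mult sums_add half_plane_series z)
    then show "(\<lambda>n. c n * z ^ n) sums \<phi> z" by (simp only: c_def distrib_right mult.assoc)
  qed
  moreover have "fps_expansion h 0 = Abs_fps b" by (simp add: fps_expansion_def b_def[abs_def])
  ultimately have "conv \<phi> h z = (\<Sum>n. c n * b n * z ^ n)" by (simp add: conv_def)
  also have "(\<lambda>n. c n * b n * z ^ n) sums ((h z + \<sigma> * (z * deriv h z)) / 2)"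
  proof -
    have hs: "(\<lambda>n. b n * z ^ n) sums h z"
      using holomorphic_power_series[OF h(1) z] by (simp add: b_def)
    have "deriv h holomorphic_on ball 0 1" using h(1) by (intro holomorphic_deriv) auto
    from holomorphic_power_series[OF this z]
    have "(\<lambda>n. (deriv ^^ Suc n) h 0 / fact n * z ^ n) sums deriv h z"
      by (simp add: funpow_Suc_right del: funpow.simps)
    then have "(\<lambda>n. z * ((deriv ^^ Suc n) h 0 / fact n * z ^ n)) sums (z * deriv h z)" by (rule sums_mult)
    also have "(\<lambda>n. z * ((deriv ^^ Suc n) h 0 / fact n * z ^ n)) = (\<lambda>n. of_nat (Suc n) * (b (Suc n) * z ^ Suc n))"
      by (rule ext) (simp add: b_def divide_simps del: funpow.simps of_nat_Suc)
    finally have ds: "(\<lambda>n. of_nat n * (b n * z ^ n)) sums (z * deriv h z)"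
      by (subst (asm) sums_Suc_iff) simp
    have "(\<lambda>n. (b n * z ^ n + \<sigma> * (of_nat n * (b n * z ^ n))) / 2) sums ((h z + \<sigma> * (z * deriv h z)) / 2)"
      by (intro sums_divide sums_add sums_mult hs ds)
    moreover have "(b n * z ^ n + \<sigma> * (of_nat n * (b n * z ^ n))) / 2 = c n * b n * z ^ n" for n
      using h(2) by (cases "n = 0") (simp_all add: b_def c_def algebra_simps)
    ultimately show ?thesis by simp
  qed
  then have "(\<Sum>n. c n * b n * z ^ n) = (h z + \<sigma> * (z * deriv h z)) / 2" by (rule sums_unique[symmetric])
  finally show ?thesis .
qed

section \<open>The convolution theorem\<close>

lemma deriv_of_contour_integral:
  fixes f F :: "complex \<Rightarrow> complex"
  assumes f: "f holomorphic_on ball 0 1"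
    and F: "\<And>z. z \<in> ball 0 1 \<Longrightarrow> F z = contour_integral (linepath 0 z) f" and z: "z \<in> ball 0 1"
  shows "(F has_field_derivative f z) (at z)"
proof -
  obtain P where P: "\<And>x. x \<in> ball 0 1 \<Longrightarrow> (P has_field_derivative f x) (at x within ball 0 1)"
    using holomorphic_convex_primitive'[OF convex_ball open_ball f] by metis
  have eq: "F x = P x - P 0" if x: "x \<in> ball 0 1" for x
  proof -
    have "closed_segment 0 x \<subseteq> ball 0 1" using x by (intro closed_segment_subset) auto
    then have "(f has_contour_integral (P (pathfinish (linepath 0 x)) - P (pathstart (linepath 0 x)))) (linepath 0 x)"
      by (intro contour_integral_primitive[where S="ball 0 1"] P) (auto simp del: linepath_0)
    then show ?thesis using F[OF x] by (simp add: contour_integral_unique)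
  qed
  have "((\<lambda>x. P x - P 0) has_field_derivative f z) (at z)"
    using P[OF z] z by (auto intro!: derivative_eq_intros simp: at_within_open[of z "ball 0 1"])
  then show ?thesis
    by (rule has_field_derivative_transform_within_open[OF _ open_ball z]) (simp add: eq)
qed

theorem theorem4p3:
  fixes \<mu> \<nu> :: real and h1 g1 h2 g2 :: "complex \<Rightarrow> complex" and a :: complex and n :: nat
  assumes h1: "\<And>z. z \<in> ball 0 1 \<Longrightarrow> h1 z = 1/2 * (z / (1 - z) + z / (1 - z)^2)"
    and g1: "\<And>z. z \<in> ball 0 1 \<Longrightarrow> g1 z = 1/2 * (z / (1 - z) - z / (1 - z)^2)"
    and f2: "normalized_harmonic h2 g2"
    and "locally_univalent_on (harmonic_fun h2 g2) (ball 0 1)"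
    and "sense_preserving_on (harmonic_fun h2 g2) (ball 0 1)"
    and "\<And>z. z \<in> ball 0 1 \<Longrightarrow>
           h2 z + exp (- 2 * \<i> * of_real \<mu>) * g2 z =
             contour_integral (linepath 0 z)
               (\<lambda>\<xi>. 1 / (1 - 2 * \<xi> * exp (\<i> * of_real \<mu>) * of_real (cos \<nu>)
                         + \<xi>^2 * exp (2 * \<i> * of_real \<mu>)))"
    and "cmod a \<le> 1" and "n \<ge> 1"
    and "\<And>z. z \<in> ball 0 1 \<Longrightarrow> deriv g2 z / deriv h2 z = a * z ^ n"
    and "(n = 1 \<or> n = 2) \<and> cmod a \<le> 1 \<or>
         n \<ge> 3 \<and> cmod a \<le> real n - 1 - sqrt (real n ^ 2 - 2 * real n)"
  shows "inj_on (harmonic_conv h1 g1 h2 g2) (ball 0 1) \<and>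
         function_convex_in_direction (- \<mu>) (harmonic_conv h1 g1 h2 g2)"
proof -
  note f2_integral = assms(6) and f2_dilatation = assms(9) and size_a = assms(10)
  have h2: "h2 holomorphic_on ball 0 1" "h2 0 = 0" and g2: "g2 holomorphic_on ball 0 1" "g2 0 = 0"
    using f2 by (auto simp: normalized_harmonic_def)
  have dh2: "(h2 has_field_derivative deriv h2 z) (at z)" and dg2: "(g2 has_field_derivative deriv g2 z) (at z)"
    if "z \<in> ball 0 1" for z
    by (rule holomorphic_derivI[OF h2(1) open_ball that], rule holomorphic_derivI[OF g2(1) open_ball that])
  define e where "e = cis \<mu>"
  define c where "c = cis (2 * - \<mu>)"
  define q where "q w = 1 - 2 * w * of_real (cos \<nu>) + w\<^sup>2" for w :: complex
  define p where "p w = (1 - w\<^sup>2) / q w" for w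
  define u where "u z = c * a * z ^ n" for z
  have exps: "exp (\<i> * of_real \<mu>) = e" "exp (2 * \<i> * of_real \<mu>) = e\<^sup>2" "exp (- 2 * \<i> * of_real \<mu>) = c"
    by (simp_all add: e_def c_def cis_conv_exp mult_ac flip: exp_of_nat_mult)
  have e: "cmod e = 1" "e \<noteq> 0" and c: "cmod c = 1" "c * e = cnj e" "e * cnj e = 1"
    by (simp_all add: e_def c_def cis_mult cis_cnj)
  have ez: "e * z \<in> ball 0 1" if "z \<in> ball 0 1" for z
    using that by (simp add: norm_mult e)
  have q: "q w \<noteq> 0" "Re (p w) > 0" if "w \<in> ball 0 1" for w
    using quadratic_factor_positive[of w "cos \<nu>"] that by (simp_all add: q_def p_def)
  have u: "cmod (u z) < 1" "cmod (u z) \<le> cmod a" if "z \<in> ball 0 1" for z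
  proof -
    have z: "cmod z < 1" using that by simp
    have "cmod (u z) = cmod a * cmod z ^ n" by (simp add: u_def norm_mult norm_power c)
    moreover have "cmod a * cmod z ^ n \<le> 1 * cmod z ^ n" "cmod a * cmod z ^ n \<le> cmod a * 1"
      by (intro mult_right_mono mult_left_mono assms(7) power_le_one zero_le_power norm_ge_zero; use z in simp)+
    moreover have "cmod z ^ n < 1" using z assms(8) by (simp add: power_less_one_iff)
    ultimately show "cmod (u z) < 1" "cmod (u z) \<le> cmod a" by auto
  qed
  have u1: "1 + u z \<noteq> 0" if "z \<in> ball 0 1" for z
    using u(1)[OF that] by (metis add_eq_0_iff less_irrefl norm_minus_cancel norm_one)

  \<comment> \<open>A zero of \<open>h\<^sub>2'\<close> would give the dilatation the value \<open>0\<close> by the convention on division, so the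
    formula for \<open>g\<^sub>2'\<close> needs the positive Jacobian.\<close>
  have h2'_nonzero: "deriv h2 z \<noteq> 0" if z: "z \<in> ball 0 1" for z
  proof -
    have "jacobian_det (harmonic_fun h2 g2) z > 0"
      using assms(5) z by (simp add: sense_preserving_on_def)
    then have "(cmod (deriv g2 z))\<^sup>2 < (cmod (deriv h2 z))\<^sup>2"
      by (simp add: jacobian_det_harmonic_fun holomorphic_on_imp_differentiable_at[OF h2(1) open_ball z]
          holomorphic_on_imp_differentiable_at[OF g2(1) open_ball z])
    then show ?thesis by (auto simp: not_less)
  qed
  have g2': "deriv g2 z = a * z ^ n * deriv h2 z" if "z \<in> ball 0 1" for z
    using f2_dilatation[OF that] h2'_nonzero[OF that] by (simp add: field_simps)
  have h2'_q: "(1 + u z) * deriv h2 z * q (e * z) = 1" if z: "z \<in> ball 0 1" for z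
  proof -
    have "(\<lambda>\<xi>. 1 / q (e * \<xi>)) holomorphic_on ball 0 1"
      using q(1)[OF ez] unfolding q_def by (intro holomorphic_intros) auto
    then have "((\<lambda>z. h2 z + c * g2 z) has_field_derivative 1 / q (e * z)) (at z)"
    proof (rule deriv_of_contour_integral[OF _ _ z])
      show "h2 z + c * g2 z = contour_integral (linepath 0 z) (\<lambda>\<xi>. 1 / q (e * \<xi>))"
        if "z \<in> ball 0 1" for z
        using f2_integral[OF that] unfolding exps by (simp add: q_def mult_ac power_mult_distrib)
    qed
    moreover have "((\<lambda>z. h2 z + c * g2 z) has_field_derivative deriv h2 z + c * deriv g2 z) (at z)"
      by (intro DERIV_add DERIV_cmult dh2 dg2 z)
    ultimately have "deriv h2 z + c * deriv g2 z = 1 / q (e * z)" by (rule DERIV_unique[rotated])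
    then show ?thesis using q(1)[OF ez[OF z]] by (simp add: g2'[OF z] u_def field_simps)
  qed

  define H where "H z = (h2 z + z * deriv h2 z) / 2" for z
  define G where "G z = (g2 z - z * deriv g2 z) / 2" for z
  have conv_eq: "harmonic_conv h1 g1 h2 g2 z = harmonic_fun H G z" if "z \<in> ball 0 1" for z
  proof -
    have "conv h1 h2 z = (h2 z + 1 * (z * deriv h2 z)) / 2"
      by (rule conv_half_plane[OF _ h2 that]) (simp add: h1)
    moreover have "conv g1 g2 z = (g2 z + (- 1) * (z * deriv g2 z)) / 2"
      by (rule conv_half_plane[OF _ g2 that]) (simp add: g1)
    ultimately show ?thesis by (simp add: harmonic_conv_def harmonic_fun_def H_def G_def del: eq_divide_eq_numeral1)
  qed
  have H: "H holomorphic_on ball 0 1" and G: "G holomorphic_on ball 0 1"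
    unfolding H_def G_def by (intro holomorphic_intros holomorphic_deriv h2 g2 open_ball; simp)+

  have dilatation: "cmod (deriv G z) < cmod (deriv H z)" if z: "z \<in> ball 0 1" for z
  proof -
    define d where "d = deriv (deriv h2) z"
    define A where "A = 1 + p (e * z) - of_nat n * u z / (1 + u z)"
    define K where "K = of_nat n * z ^ (n - 1)"
    have zK: "z * K = of_nat n * z ^ n"
      unfolding K_def using assms(8) by (cases n) simp_all
    have dd: "(deriv h2 has_field_derivative d) (at z)"
      unfolding d_def by (rule holomorphic_derivI[OF holomorphic_deriv[OF h2(1) open_ball] open_ball z])
    have ddg: "(deriv g2 has_field_derivative a * K * deriv h2 z + a * z ^ n * d) (at z)"
    proof (rule has_field_derivative_transform_within_open[OF _ open_ball z])
      show "((\<lambda>z. a * z ^ n * deriv h2 z) has_field_derivative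
          a * K * deriv h2 z + a * z ^ n * d) (at z)"
        unfolding K_def using dd by (auto intro!: derivative_eq_intros)
    qed (simp add: g2')
    \<comment> \<open>Differentiating the identity \<open>(1 + u) h\<^sub>2' q = 1\<close> expresses \<open>z h\<^sub>2'' / h\<^sub>2'\<close>
      through \<open>p\<close> and \<open>u\<close>.\<close>
    have zd: "z * d = deriv h2 z * (A - 2)"
    proof -
      have "((\<lambda>z. (1 + u z) * deriv h2 z * q (e * z)) has_field_derivative
          c * a * K * deriv h2 z * q (e * z) + (1 + u z) * d * q (e * z)
            + (1 + u z) * deriv h2 z * (2 * (e * z) * e - 2 * e * of_real (cos \<nu>))) (at z)"
        unfolding u_def q_def K_def
        by (rule derivative_eq_intros dd refl | simp)+ (simp add: algebra_simps)
      moreover have "((\<lambda>z. (1 + u z) * deriv h2 z * q (e * z)) has_field_derivative 0) (at z)"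
        by (rule has_field_derivative_transform_within_open[OF DERIV_const open_ball z]) (simp add: h2'_q)
      ultimately have "c * a * K * deriv h2 z * q (e * z) + (1 + u z) * d * q (e * z)
            + (1 + u z) * deriv h2 z * (2 * (e * z) * e - 2 * e * of_real (cos \<nu>)) = 0"
        by (rule DERIV_unique)
      then have "z * (c * a * K * deriv h2 z * q (e * z) + (1 + u z) * d * q (e * z)
            + (1 + u z) * deriv h2 z * (2 * (e * z) * e - 2 * e * of_real (cos \<nu>))) = 0" by simp
      moreover have "z * (c * a * K) = of_nat n * u z"
        using zK by (simp add: u_def mult_ac)
      moreover have combine: "m * h * Q + U * (z * d) * Q + U * h * (2 * (e * z)\<^sup>2 - 2 * (e * z) * C) = 0"
        if "z * (k * h * Q + U * d * Q + U * h * (2 * (e * z) * e - 2 * e * C)) = 0" "z * k = m"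
        for k h Q U C m :: complex
        using that by algebra
      ultimately have 0: "of_nat n * u z * deriv h2 z * q (e * z) + (1 + u z) * (z * d) * q (e * z)
            + (1 + u z) * deriv h2 z * (2 * (e * z)\<^sup>2 - 2 * (e * z) * of_real (cos \<nu>)) = 0"
        using combine by blast
      have "A - 2 = p (e * z) - 1 - of_nat n * u z / (1 + u z)" by (simp add: A_def)
      also have "p (e * z) - 1 = (1 - (e * z)\<^sup>2 - q (e * z)) / q (e * z)"
        using q(1)[OF ez[OF z]] by (simp add: p_def diff_divide_distrib)
      also have "1 - (e * z)\<^sup>2 - q (e * z) = 2 * (e * z) * of_real (cos \<nu>) - 2 * (e * z)\<^sup>2"
        by (simp add: q_def)
      finally have A: "A - 2 = (2 * (e * z) * of_real (cos \<nu>) - 2 * (e * z)\<^sup>2) / q (e * z)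
          - of_nat n * u z / (1 + u z)" .
      have clear: "(X / Q - M / U) * (Q * U) = X * U - M * Q" if "Q \<noteq> 0" "U \<noteq> 0" for X Q M U :: complex
        using that by (simp add: field_simps)
      have A2: "(A - 2) * (q (e * z) * (1 + u z))
          = (2 * (e * z) * of_real (cos \<nu>) - 2 * (e * z)\<^sup>2) * (1 + u z) - of_nat n * u z * q (e * z)"
        unfolding A using q(1)[OF ez[OF z]] u1[OF z] by (rule clear)
      have "(z * d) * (q (e * z) * (1 + u z)) = (deriv h2 z * (A - 2)) * (q (e * z) * (1 + u z))"
      proof -
        have "(z * d) * (Q * U) = (h * B) * (Q * U)"
          if "N * h * Q + U * (z * d) * Q + U * h * (Y - X) = 0" "B * (Q * U) = (X - Y) * U - N * Q"
          for N h Q U B X Y :: complex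
          using that by algebra
        from this[OF 0 A2] show ?thesis .
      qed
      then show ?thesis using q(1)[OF ez[OF z]] u1[OF z] by simp
    qed
    have "(H has_field_derivative (deriv h2 z + (deriv h2 z + z * d)) / 2) (at z)"
      unfolding H_def using dh2[OF z] dd by (auto intro!: derivative_eq_intros)
    then have H': "deriv H z = deriv h2 z * A / 2"
      using zd by (simp add: DERIV_imp_deriv algebra_simps)
    have "(G has_field_derivative (deriv g2 z - (deriv g2 z +
        z * (a * K * deriv h2 z + a * z ^ n * d))) / 2) (at z)"
      unfolding G_def using dg2[OF z] ddg by (auto intro!: derivative_eq_intros)
    moreover have "(deriv g2 z - (deriv g2 z +
        z * (a * K * deriv h2 z + a * z ^ n * d))) / 2
        = - (deriv h2 z * (a * z ^ n) * (A + of_nat n - 2)) / 2"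
    proof -
      have "z * (a * K * deriv h2 z + a * z ^ n * d) = a * (z * K) * deriv h2 z + a * z ^ n * (z * d)"
        by (simp add: algebra_simps)
      also have "\<dots> = deriv h2 z * (a * z ^ n) * (A + of_nat n - 2)"
        unfolding zK zd by (simp add: algebra_simps)
      finally show ?thesis by simp
    qed
    ultimately have G': "deriv G z = - (deriv h2 z * (a * z ^ n) * (A + of_nat n - 2)) / 2"
      by (simp add: DERIV_imp_deriv)
    have "cmod (u z * (A + of_nat n - 2)) < cmod A"
      unfolding A_def
    proof (rule dilatation_estimate[OF q(2)[OF ez[OF z]] u(1)[OF z]])
      show "0 \<le> 1 - 2 * (real n - 1) * cmod (u z) + (cmod (u z))\<^sup>2"
        using size_a
      proof (elim disjE conjE)
        assume "n = 2"
        moreover have "0 \<le> (1 - cmod (u z))\<^sup>2" by simp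
        ultimately show ?thesis by (simp add: power2_eq_square algebra_simps)
      next
        assume n: "n \<ge> 3" "cmod a \<le> real n - 1 - sqrt (real n ^ 2 - 2 * real n)"
        then have "sqrt (real n ^ 2 - 2 * real n) \<le> real n - 1 - cmod (u z)" using u(2)[OF z] by linarith
        then have "real n ^ 2 - 2 * real n \<le> (real n - 1 - cmod (u z))\<^sup>2" by (rule sqrt_le_D)
        then show ?thesis by (simp add: power2_eq_square algebra_simps)
      qed simp
    qed
    then have "cmod (a * z ^ n) * cmod (A + of_nat n - 2) < cmod A"
      by (simp add: u_def norm_mult c)
    then have "cmod (deriv h2 z) * (cmod (a * z ^ n) * cmod (A + of_nat n - 2)) < cmod (deriv h2 z) * cmod A"
      using h2'_nonzero[OF z] by simp
    then show ?thesis by (simp add: H' G' norm_mult norm_divide mult.assoc)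
  qed

  \<comment> \<open>In the rotated variable \<open>w = e z\<close> the shear \<open>H - c G\<close> becomes \<open>\<Psi>\<close>, up to the factor \<open>cnj e\<close>: the terms
    \<open>z h\<^sub>2'\<close> and \<open>z g\<^sub>2'\<close> combine to \<open>z (h\<^sub>2' + c g\<^sub>2')\<close>, which is \<open>w / q\<close> up to this factor.\<close>
  define B where "B w = e * (h2 (cnj e * w) - c * g2 (cnj e * w)) / 2" for w
  define \<Psi> where "\<Psi> w = B w + of_real (1 / 2) * (w / q w)" for w
  have ez': "cnj e * w \<in> ball 0 1" if "w \<in> ball 0 1" for w
    using that by (simp add: norm_mult e)
  have dB: "(B has_field_derivative (deriv h2 (cnj e * w) - c * deriv g2 (cnj e * w)) / 2) (at w)"
    if "w \<in> ball 0 1" for w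
  proof -
    have "((\<lambda>w. h2 (cnj e * w)) has_field_derivative deriv h2 (cnj e * w) * cnj e) (at w)"
      "((\<lambda>w. g2 (cnj e * w)) has_field_derivative deriv g2 (cnj e * w) * cnj e) (at w)"
      using DERIV_chain2[where f=h2 and g="\<lambda>w. cnj e * w" and x=w, OF dh2[OF ez'[OF that]]]
        DERIV_chain2[where f=g2 and g="\<lambda>w. cnj e * w" and x=w, OF dg2[OF ez'[OF that]]]
      by (auto intro!: derivative_eq_intros)
    then have "(B has_field_derivative e * (deriv h2 (cnj e * w) * cnj e - c * (deriv g2 (cnj e * w) * cnj e)) / 2) (at w)"
      unfolding B_def by (intro DERIV_cdivide DERIV_cmult DERIV_diff)
    also have "e * (deriv h2 (cnj e * w) * cnj e - c * (deriv g2 (cnj e * w) * cnj e)) / 2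
        = (deriv h2 (cnj e * w) - c * deriv g2 (cnj e * w)) / 2"
      using c(3) by algebra
    finally show ?thesis .
  qed
  have B_pos: "Re (deriv B w * q w) > 0" if w: "w \<in> ball 0 1" for w
  proof -
    define z where "z = cnj e * w"
    have z: "z \<in> ball 0 1" and ez_w: "e * z = w" using ez'[OF w] c(3) by (simp_all add: z_def flip: mult.assoc)
    have "deriv B w * q w = ((1 - u z) * deriv h2 z * q w) / 2"
      unfolding DERIV_imp_deriv[OF dB[OF w]] z_def[symmetric] g2'[OF z] by (simp add: u_def algebra_simps)
    also have "(1 - u z) * deriv h2 z * q w = (1 - u z) / (1 + u z)"
      using h2'_q[OF z] u1[OF z] unfolding ez_w by (simp add: eq_divide_eq mult_ac)
    finally have "deriv B w * q w = (1 - u z) / (1 + u z) / 2" .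
    moreover have "Re ((1 - u z) / (1 + u z)) > 0" using Re_Cayley_pos[of "- u z"] u(1)[OF z] by simp
    ultimately show ?thesis by (simp only: Re_divide_numeral)
  qed
  have B_hol: "B holomorphic_on ball 0 1" unfolding holomorphic_on_open[OF open_ball] using dB by blast
  have \<Psi>: "inj_on \<Psi> (ball 0 1)" "convex_in_direction 0 (\<Psi> ` ball 0 1)"
    using horizontally_convex_of_kernel[OF B_hol B_pos[unfolded q_def], of "1 / 2"]
    by (simp_all only: \<Psi>_def[abs_def] q_def)
  have \<Psi>_eq: "H z - c * G z = cnj e * \<Psi> (e * z)" if z: "z \<in> ball 0 1" for z
  proof -
    have "cnj e * (e * z) = z" using c(3) by (simp add: mult.commute flip: mult.assoc)
    then have "\<Psi> (e * z) = e * (h2 z - c * g2 z) / 2 + e * z / q (e * z) / 2"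
      unfolding \<Psi>_def B_def by (simp only:) simp
    moreover have "1 / q (e * z) = deriv h2 z + c * deriv g2 z"
      using h2'_q[OF z] q(1)[OF ez[OF z]] by (simp add: g2'[OF z] u_def field_simps)
    then have "e * z / q (e * z) = e * z * (deriv h2 z + c * deriv g2 z)" by (metis times_divide_eq_right mult.right_neutral)
    ultimately have "\<Psi> (e * z) = e * (H z - c * G z)" by (simp add: H_def G_def field_simps)
    then show ?thesis using c(3) by (simp add: mult.commute flip: mult.assoc)
  qed
  have inj: "inj_on (\<lambda>z. H z - c * G z) (ball 0 1)"
  proof (rule inj_onI)
    fix z1 z2 assume z: "z1 \<in> ball 0 1" "z2 \<in> ball 0 1"
      and "H z1 - c * G z1 = H z2 - c * G z2"
    then have "\<Psi> (e * z1) = \<Psi> (e * z2)" using e(2) by (simp add: \<Psi>_eq)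
    then show "z1 = z2" using inj_onD[OF \<Psi>(1) _ ez ez] z e(2) by simp
  qed
  have "(*) e ` ball 0 1 = ball 0 1"
  proof (intro equalityI subsetI)
    fix w assume "w \<in> ball (0::complex) 1"
    moreover have "w = e * (cnj e * w)" using c(3) by (simp flip: mult.assoc)
    ultimately show "w \<in> (*) e ` ball 0 1" using ez' by blast
  qed (use ez in auto)
  then have "(*) (cis (- \<mu>)) ` \<Psi> ` ball 0 1 = (\<lambda>z. cnj e * \<Psi> (e * z)) ` ball 0 1"
    by (simp add: e_def cis_cnj image_comp comp_def) (metis image_image)
  also have "\<dots> = (\<lambda>z. H z - c * G z) ` ball 0 1"
    by (rule image_cong) (simp_all add: \<Psi>_eq)
  finally have cvx: "convex_in_direction (- \<mu>) ((\<lambda>z. H z - c * G z) ` ball 0 1)"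
    using convex_in_direction_rotate[OF \<Psi>(2), of "- \<mu>"] by simp

  note f = shear_construction[OF open_ball H G dilatation inj[unfolded c_def] cvx[unfolded c_def]]
  have "continuous_on (ball 0 1) (harmonic_fun H G)"
    unfolding harmonic_fun_def using H G by (intro continuous_intros holomorphic_on_imp_continuous_on)
  then have "open (harmonic_fun H G ` ball 0 1)" "connected (harmonic_fun H G ` ball 0 1)"
    using f(1) by (auto intro: invariance_of_domain connected_continuous_image)
  with f have "inj_on (harmonic_fun H G) (ball 0 1) \<and> function_convex_in_direction (- \<mu>) (harmonic_fun H G)"
    by (simp add: function_convex_in_direction_def)
  moreover have "harmonic_conv h1 g1 h2 g2 ` ball 0 1 = harmonic_fun H G ` ball 0 1"
    by (rule image_cong) (simp_all add: conv_eq)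
  ultimately show ?thesis
    using inj_on_cong[of "ball 0 1" "harmonic_conv h1 g1 h2 g2" "harmonic_fun H G"] conv_eq
    by (simp add: function_convex_in_direction_def)
qed

end
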